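(* Let $G$ be the 1-skeleton of a cell-decomposition $\Delta$ of $\mathbb{R}^d$ by convex polyhedra. If there is a convex surface in $\mathbb{R}^{d+1}$ which projects onto $\Delta$, then $G$ supports an equilibrium stress that is positive at all edges, and therefore $G$ is an infinite spider web.
   Context: The cell-decomposition is a face-to-face decomposition of $\mathbb{R}^d$ into (possibly unbounded) convex $d$-dimensional polyhedra, with at most countably many cells. A convex surface projects onto $\Delta$ if it is a piecewise-linear convex hypersurface in $\mathbb{R}^{d+1}$ (the graph of a convex piecewise-linear function on $\mathbb{R}^d$) whose facets project bijectively, under the vertical projection $\mathbb{R}^{d+1}\to\mathbb{R}^d$, onto the $d$-cells of $\Delta$, adjacent $d$-cells corresponding to facets lying in distinct hyperplanes. A self-stress (equilibrium stress) on a framework in $\mathbb{R}^d$ is an assignment of real numbers $s_e$ to the edges such that at each vertex $\mathbf{v}$ one has $\sum_{e\ni \mathbf{v}} s_e\,\mathbf{u}(\mathbf{v},e)=\mathbf{0}$, where $\mathbf{u}(\mathbf{v},e)$ is the unit vector pointing from $\mathbf{v}$ along the edge $e$ (for a bounded edge with endpoints $\mathbf{v},\mathbf{w}$ this is $(\mathbf{w}-\mathbf{v})/\|\mathbf{w}-\mathbf{v}\|$). Vertices at infinity are allowed, i.e. edges may be unbounded; no condition is imposed at infinity. A spider web is a framework (with vertices at infinity allowed) which supports a self-stress that is strictly positive on all edges. *)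

theory Defs
  imports "HOL-Analysis.Analysis"
begin

section \<open>Cell-decompositions and their 1-skeleta\<close>

text \<open>
  A cell-decomposition of $\mathbb{R}^d$, with $d$ = \<open>DIM('a)\<close>, is represented by the set of
  its $d$-cells; its lower-dimensional cells are the faces of these.
\<close>

definition cell_decomposition :: "'a::euclidean_space set set \<Rightarrow> bool" where
  "cell_decomposition \<Delta> \<longleftrightarrow>
     countable \<Delta> \<and>
     (\<forall>C\<in>\<Delta>. polyhedron C \<and> aff_dim C = int DIM('a)) \<and>
     \<Union>\<Delta> = UNIV \<and>
     (\<forall>C\<in>\<Delta>. \<forall>D\<in>\<Delta>. (C \<inter> D) face_of C \<and> (C \<inter> D) face_of D)"

definition adjacent_cells :: "'a::euclidean_space set \<Rightarrow> 'a set \<Rightarrow> bool" where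
  "adjacent_cells C D \<longleftrightarrow> C \<noteq> D \<and> (C \<inter> D) facet_of C \<and> (C \<inter> D) facet_of D"

definition skeleton_vertices :: "'a::euclidean_space set set \<Rightarrow> 'a set" where
  "skeleton_vertices \<Delta> = {v. \<exists>C\<in>\<Delta>. v extreme_point_of C}"

definition skeleton_edges :: "'a::euclidean_space set set \<Rightarrow> 'a set set" where
  "skeleton_edges \<Delta> = {e. \<exists>C\<in>\<Delta>. e edge_of C}"


section \<open>Convex surfaces projecting onto a cell-decomposition\<close>

text \<open>
  Piecewise linear in the usual, locally finite sense: near every point the function is
  composed of finitely many affine functions \<open>\<lambda>y. a \<bullet> y + b\<close>.
\<close>

definition piecewise_linear :: "('a::euclidean_space \<Rightarrow> real) \<Rightarrow> bool" where
  "piecewise_linear f \<longleftrightarrow>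
     continuous_on UNIV f \<and>
     (\<forall>x. \<exists>U L. open U \<and> x \<in> U \<and> finite L \<and> (\<forall>y\<in>U. \<exists>(a, b)\<in>L. f y = a \<bullet> y + b))"

definition convex_surface :: "('a::euclidean_space \<times> real) set \<Rightarrow> bool" where
  "convex_surface S \<longleftrightarrow>
     (\<exists>f. convex_on UNIV f \<and> piecewise_linear f \<and> S = range (\<lambda>x. (x, f x)))"

text \<open>
  The facets of a convex surface are the facets of the closed convex region above it (the
  epigraph of the function whose graph is the surface). As the function is finite on all of
  $\mathbb{R}^d$, none of them is vertical and all of them lie in the surface.
\<close>

definition surface_facets :: "('a::euclidean_space \<times> real) set \<Rightarrow> ('a \<times> real) set set" where
  "surface_facets S = {F. F facet_of {(x, t). \<exists>y\<le>t. (x, y) \<in> S}}"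

definition projects_onto :: "('a::euclidean_space \<times> real) set \<Rightarrow> 'a set set \<Rightarrow> bool" where
  "projects_onto S \<Delta> \<longleftrightarrow>
     bij_betw (\<lambda>F. fst ` F) (surface_facets S) \<Delta> \<and>
     (\<forall>F\<in>surface_facets S. inj_on fst F) \<and>
     (\<forall>F\<in>surface_facets S. \<forall>F'\<in>surface_facets S.
        adjacent_cells (fst ` F) (fst ` F') \<longrightarrow> affine hull F \<noteq> affine hull F')"


section \<open>Frameworks, self-stresses and spider webs\<close>

text \<open>
  An edge of a framework is a closed convex set of dimension one: a segment, or, if it has one
  or two vertices at infinity, a ray or a line. Its (finite) endpoints are its extreme points.
\<close>

definition framework :: "'a::euclidean_space set \<Rightarrow> 'a set set \<Rightarrow> bool" where
  "framework V E \<longleftrightarrow>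
     (\<forall>e\<in>E. closed e \<and> convex e \<and> aff_dim e = 1 \<and> (\<forall>v. v extreme_point_of e \<longrightarrow> v \<in> V))"

text \<open>The description below determines the vector uniquely whenever \<open>v\<close> is an endpoint of \<open>e\<close>.\<close>

definition edge_unit_vector :: "'a::euclidean_space \<Rightarrow> 'a set \<Rightarrow> 'a" where
  "edge_unit_vector v e = (THE u. \<exists>w\<in>e. w \<noteq> v \<and> u = (w - v) /\<^sub>R norm (w - v))"

lemma edge_unit_vector_closed_segment:
  assumes "v \<noteq> w"
  shows "edge_unit_vector v (closed_segment v w) = (w - v) /\<^sub>R norm (w - v)"
  unfolding edge_unit_vector_def
proof (rule the_equality)
  show "\<exists>w'\<in>closed_segment v w. w' \<noteq> v \<and> (w - v) /\<^sub>R norm (w - v) = (w' - v) /\<^sub>R norm (w' - v)"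
    using assms by (intro bexI[of _ w]) auto
next
  fix u assume "\<exists>w'\<in>closed_segment v w. w' \<noteq> v \<and> u = (w' - v) /\<^sub>R norm (w' - v)"
  then obtain w' where w': "w' \<in> closed_segment v w" "w' \<noteq> v" "u = (w' - v) /\<^sub>R norm (w' - v)"
    by blast
  then obtain t where t: "0 \<le> t" "w' = (1 - t) *\<^sub>R v + t *\<^sub>R w"
    by (auto simp: in_segment)
  then have d: "w' - v = t *\<^sub>R (w - v)"
    by (simp add: algebra_simps)
  with w' t have "t > 0"
    by (auto simp: less_le)
  then show "u = (w - v) /\<^sub>R norm (w - v)"
    unfolding w'(3) d by simp
qed

definition incident_edges :: "'a::euclidean_space set set \<Rightarrow> 'a \<Rightarrow> 'a set set" where
  "incident_edges E v = {e \<in> E. v extreme_point_of e}"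

text \<open>
  Finiteness is demanded explicitly because \<^const>\<open>sum\<close> vanishes on infinite sets. Nothing is
  required at infinity, as only the points of \<open>V\<close> carry a condition.
\<close>

definition self_stress :: "'a::euclidean_space set \<Rightarrow> 'a set set \<Rightarrow> ('a set \<Rightarrow> real) \<Rightarrow> bool" where
  "self_stress V E s \<longleftrightarrow>
     (\<forall>v\<in>V. finite (incident_edges E v) \<and>
             (\<Sum>e\<in>incident_edges E v. s e *\<^sub>R edge_unit_vector v e) = 0)"

definition spider_web :: "'a::euclidean_space set \<Rightarrow> 'a set set \<Rightarrow> bool" where
  "spider_web V E \<longleftrightarrow> framework V E \<and> (\<exists>s. self_stress V E s \<and> (\<forall>e\<in>E. s e > 0))"

end

theory Submission
  imports Defs
begin

text \<open>
  The stress comes from the reciprocal figure of Maxwell. A convex surface that projects onto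
  \<open>\<Delta>\<close> is the graph of a function \<open>f\<close> that is the maximum of affine functions, one for each cell \<open>C\<close>,
  with gradient \<open>g C\<close>; the cell is the set where its affine function attains the maximum
  (\<open>max_affine_cells_of_surface\<close>). A face \<open>e\<close> of the decomposition has as dual cell the convex hull
  of the gradients of the cells containing \<open>e\<close>. The stress of an edge is the volume of its dual
  cell, measured in the hyperplane orthogonal to the edge in which the dual cell lies.

  The stress is positive because the dual cell of an edge has full dimension in this hyperplane:
  if the gradients around the edge had equal components in a further direction, one
  could move in that direction without leaving any of the cells around the edge, hence without
  leaving the edge (\<open>constant_slope_tangent\<close>, \<open>dual_edge_volume_pos\<close>).

  The stress is in equilibrium because of the Minkowski relation: the outer unit normals of the
  facets of a polytope, weighted with the volumes of the facets, add up to zero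
  (\<open>minkowski_relation\<close>). The polytope to use at a vertex is the dual cell of that vertex. Since
  \<open>f\<close> is a maximum, the cells that contain an edge at the vertex are those whose gradients have the
  largest component along it, so the dual cell of the edge is the face of the polytope with outer
  normal along the edge (\<open>dual_edge_face_of_dual_vertex\<close>); and every facet arises from an edge
  (\<open>edge_of_dual_facet\<close>).

  The Minkowski relation itself follows by moving the polytope along a vector \<open>w\<close>. The volume
  gained in front is the sum of the volumes of prisms over the facets facing \<open>w\<close>, and the volume
  of a prism is that of its base times its height. The gain is the same for \<open>- w\<close>, where the
  facets facing away from \<open>w\<close> contribute.
\<close>

section \<open>Prisms over sets in a hyperplane\<close>

text \<open>
  The segment from \<open>0\<close> to \<open>w\<close>, added to every point of \<open>F\<close>. For \<open>F\<close> in a hyperplane with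
  unit normal \<open>u\<close>, the Lebesgue measure of \<open>prism F u\<close> is the volume of \<open>F\<close> inside its hyperplane,
  since the height is 1; in this way only Lebesgue measure on the ambient space occurs.
\<close>
definition prism :: "'a::euclidean_space set \<Rightarrow> 'a \<Rightarrow> 'a set" where
  "prism F w = (\<lambda>(x, t). x + t *\<^sub>R w) ` (F \<times> {0..1})"

lemma mem_prism: "y \<in> prism F w \<longleftrightarrow> (\<exists>x\<in>F. \<exists>t. 0 \<le> t \<and> t \<le> 1 \<and> y = x + t *\<^sub>R w)"
  by (fastforce simp: prism_def image_iff)

lemma compact_prism: "compact F \<Longrightarrow> compact (prism F w)"
  unfolding prism_def
  by (intro compact_continuous_image compact_Times compact_Icc)
     (auto simp: case_prod_unfold intro!: continuous_intros)

lemma lmeasurable_prism: "compact F \<Longrightarrow> prism F w \<in> lmeasurable"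
  by (intro lmeasurable_compact compact_prism)

lemma convex_prism:
  assumes "convex F"
  shows "convex (prism F w)"
proof -
  have "linear (\<lambda>(x::'a, t). x + t *\<^sub>R w)"
    by (rule linearI) (auto simp: algebra_simps)
  then show ?thesis
    unfolding prism_def by (intro convex_linear_image convex_Times assms) auto
qed

lemma prism_uminus: "prism F (- w) = (+) (- w) ` prism F w"
proof (intro set_eqI iffI)
  fix y assume "y \<in> prism F (- w)"
  then obtain x t where "x \<in> F" "0 \<le> t" "t \<le> 1" "y = x + t *\<^sub>R (- w)"
    by (auto simp: mem_prism)
  then have "x + (1 - t) *\<^sub>R w \<in> prism F w" "y = - w + (x + (1 - t) *\<^sub>R w)"
    by (auto simp: mem_prism algebra_simps intro!: bexI[of _ x] exI[of _ "1 - t"])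
  then show "y \<in> (+) (- w) ` prism F w" by blast
next
  fix y assume "y \<in> (+) (- w) ` prism F w"
  then obtain x t where "x \<in> F" "0 \<le> t" "t \<le> 1" "y = - w + (x + t *\<^sub>R w)"
    by (auto simp: mem_prism)
  then show "y \<in> prism F (- w)"
    by (auto simp: mem_prism algebra_simps intro!: bexI[of _ x] exI[of _ "1 - t"])
qed

lemma measure_prism_uminus: "measure lebesgue (prism F (- w)) = measure lebesgue (prism F w)"
  by (simp only: prism_uminus measure_translation)

text \<open>
  Translates of a prism by multiples of \<open>w\<close> stack up to a longer prism and overlap only inside
  hyperplanes parallel to the one that contains the base.
\<close>
lemma measure_prism_mult_nat:
  fixes F :: "'a::euclidean_space set"
  assumes F: "compact F" "F \<subseteq> {x. u \<bullet> x = h}" and u: "u \<bullet> w > 0"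
  shows "measure lebesgue (prism F (real n *\<^sub>R w)) = n * measure lebesgue (prism F w)"
proof (induction n)
  case 0
  have "negligible (prism F 0)"
    by (rule negligible_subset[OF negligible_hyperplane[of u h]])
       (use F u in \<open>auto simp: mem_prism\<close>)
  then show ?case by (simp add: negligible_imp_measure0)
next
  case (Suc n)
  let ?A = "prism F (real n *\<^sub>R w)" and ?B = "(+) (real n *\<^sub>R w) ` prism F w"
  have un: "prism F (real (Suc n) *\<^sub>R w) = ?A \<union> ?B"
  proof (intro set_eqI iffI)
    fix y assume "y \<in> prism F (real (Suc n) *\<^sub>R w)"
    then obtain x and t :: real where x: "x \<in> F" "0 \<le> t" "t \<le> 1" and y: "y = x + (t * Suc n) *\<^sub>R w"
      by (auto simp: mem_prism)
    show "y \<in> ?A \<union> ?B"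
    proof (cases "t * Suc n \<le> n")
      case True
      then have "y \<in> ?A"
      proof (cases "n = 0")
        case False
        then show ?thesis using x y True unfolding mem_prism
          by (intro bexI[of _ x] exI[of _ "t * Suc n / n"]) (auto simp: divide_simps)
      qed (use x y in \<open>auto simp: mem_prism intro!: bexI[of _ x] exI[of _ 0]\<close>)
      then show ?thesis ..
    next
      case False
      have "t * real n \<le> 1 * real n" using x by (intro mult_right_mono) auto
      then have "t * Suc n - n \<le> 1" using x by (simp add: algebra_simps)
      then have "x + (t * Suc n - n) *\<^sub>R w \<in> prism F w"
        using x False unfolding mem_prism
        by (intro bexI[of _ x] exI[of _ "t * Suc n - n"]) simp_all
      moreover have "y = real n *\<^sub>R w + (x + (t * Suc n - n) *\<^sub>R w)"
        unfolding y by (simp add: algebra_simps)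
      ultimately show ?thesis by blast
    qed
  next
    fix y assume "y \<in> ?A \<union> ?B"
    then consider "y \<in> ?A" | "y \<in> ?B" by blast
    then show "y \<in> prism F (real (Suc n) *\<^sub>R w)"
    proof cases
      case 1
      then obtain x and t :: real where x: "x \<in> F" "0 \<le> t" "t \<le> 1" and y: "y = x + (t * n) *\<^sub>R w"
        by (auto simp: mem_prism)
      have "t * real n \<le> 1 * real (Suc n)" using x by (intro mult_mono) auto
      then show ?thesis using x y unfolding mem_prism
        by (intro bexI[of _ x] exI[of _ "t * n / Suc n"]) auto
    next
      case 2
      then obtain x t where x: "x \<in> F" "0 \<le> t" "t \<le> 1" and y: "y = real n *\<^sub>R w + (x + t *\<^sub>R w)"
        by (auto simp: mem_prism)
      have "y = x + ((n + t) / Suc n) *\<^sub>R (real (Suc n) *\<^sub>R w)"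
        unfolding y scaleR_scaleR by (simp add: scaleR_add_left)
      then show ?thesis using x unfolding mem_prism
        by (intro bexI[of _ x] exI[of _ "(n + t) / Suc n"]) auto
    qed
  qed
  have neg: "negligible (?A \<inter> ?B)"
  proof (rule negligible_subset[OF negligible_hyperplane[of u "h + n * (u \<bullet> w)"]])
    show "u \<noteq> 0 \<or> h + n * (u \<bullet> w) \<noteq> 0" using u by auto
    show "?A \<inter> ?B \<subseteq> {x. u \<bullet> x = h + real n * (u \<bullet> w)}"
    proof safe
      fix y assume "y \<in> ?A" and "y \<in> prism F w"
    next
      fix z assume A: "real n *\<^sub>R w + z \<in> ?A" and B: "z \<in> prism F w"
      from A obtain x and t :: real where x: "x \<in> F" "0 \<le> t" "t \<le> 1" "real n *\<^sub>R w + z = x + (t * n) *\<^sub>R w"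
        by (auto simp: mem_prism)
      then have 1: "u \<bullet> (real n *\<^sub>R w + z) = h + t * n * (u \<bullet> w)"
        using F(2) by (auto simp: inner_simps)
      from B obtain x' t' where x': "x' \<in> F" "0 \<le> t'" "t' \<le> 1" "z = x' + t' *\<^sub>R w"
        by (auto simp: mem_prism)
      then have 2: "u \<bullet> (real n *\<^sub>R w + z) = h + n * (u \<bullet> w) + t' * (u \<bullet> w)"
        using F(2) by (auto simp: inner_simps)
      have "t * (n * (u \<bullet> w)) \<le> 1 * (n * (u \<bullet> w))" using x u by (intro mult_right_mono) auto
      moreover have "t' * (u \<bullet> w) \<ge> 0" using x' u by simp
      ultimately show "u \<bullet> (real n *\<^sub>R w + z) = h + real n * (u \<bullet> w)"
        using 1 2 unfolding mult.assoc by linarith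
    qed
  qed
  have "measure lebesgue (?A \<union> ?B) = measure lebesgue ?A + measure lebesgue ?B"
    using F(1) neg
    by (simp add: measure_Un3 lmeasurable_prism measurable_translation negligible_imp_measure0)
  then show ?case
    unfolding un measure_translation Suc by (simp add: algebra_simps)
qed

lemma prism_mono:
  assumes "F \<subseteq> F'" "0 \<le> s" "s \<le> t"
  shows "prism F (s *\<^sub>R w) \<subseteq> prism F' (t *\<^sub>R w)"
proof
  fix y assume "y \<in> prism F (s *\<^sub>R w)"
  then obtain x r where x: "x \<in> F" "0 \<le> r" "r \<le> 1" "y = x + (r * s) *\<^sub>R w"
    by (auto simp: mem_prism)
  have "r * s \<le> 1 * t" using x assms by (intro mult_mono) auto
  then show "y \<in> prism F' (t *\<^sub>R w)"
    using x assms unfolding mem_prism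
    by (cases "t = 0") (auto intro!: bexI[of _ x] exI[of _ "r * s / t"] simp: divide_simps)
qed

text \<open>
  From integer to real factors: \<open>N * t\<close> lies between consecutive integers, the measure is monotone
  in the length of the prism, and the resulting error is at most a constant divided by \<open>N\<close>.
\<close>
lemma measure_prism_scaleR:
  fixes F :: "'a::euclidean_space set"
  assumes F: "compact F" "F \<subseteq> {x. u \<bullet> x = h}" and u: "u \<bullet> w > 0" and t: "t > 0"
  shows "measure lebesgue (prism F (t *\<^sub>R w)) = t * measure lebesgue (prism F w)"
proof -
  define m where "m s = measure lebesgue (prism F (s *\<^sub>R w))" for s
  have mono: "m r \<le> m s" if "0 \<le> r" "r \<le> s" for r s
    unfolding m_def using that F(1)
    by (intro measure_mono_fmeasurable prism_mono fmeasurableD lmeasurable_prism) auto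
  have nat: "m (real n * s) = n * m s" if "s > 0" for n s
    using measure_prism_mult_nat[OF F, of "s *\<^sub>R w" n] that u by (simp add: m_def)
  have "\<bar>m t - t * m 1\<bar> \<le> m 1 / real (Suc n)" for n
  proof -
    define N where "N = Suc n"
    define k where "k = nat \<lfloor>N * t\<rfloor>"
    have k: "real k \<le> N * t" "N * t \<le> real k + 1"
      using t by (auto simp: k_def)
    have "k * m 1 \<le> N * m t" "N * m t \<le> (k + 1) * m 1"
      using mono[of "real k * 1" "N * t"] mono[of "N * t" "real (k + 1) * 1"] k t
        nat[of 1 k] nat[of 1 "k + 1"] nat[of t N] by auto
    moreover have "m 1 \<ge> 0" by (simp add: m_def)
    then have "k * m 1 \<le> N * t * m 1" "N * t * m 1 \<le> (k + 1) * m 1"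
      using k by (auto intro!: mult_right_mono)
    ultimately have "\<bar>N * m t - N * t * m 1\<bar> \<le> m 1"
      by (auto simp: algebra_simps abs_le_iff)
    then have "\<bar>N * (m t - t * m 1)\<bar> \<le> m 1" by (simp add: algebra_simps)
    then have "N * \<bar>m t - t * m 1\<bar> \<le> m 1" by (simp add: abs_mult)
    then show ?thesis by (simp add: N_def field_simps)
  qed
  moreover have "(\<lambda>n. m 1 / real (Suc n)) \<longlonglongrightarrow> 0"
    by (rule LIMSEQ_Suc[OF lim_const_over_n])
  ultimately have "\<bar>m t - t * m 1\<bar> \<le> 0"
    by (intro LIMSEQ_le_const) auto
  then show ?thesis by (simp add: m_def)
qed

text \<open>
  Cavalieri's principle for prisms of equal height, without determinants or Fubini. A thin prism of
  direction \<open>w' / n\<close> fits into one of direction \<open>w / n\<close> whose base \<open>F\<close> is enlarged by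
  \<open>(w' - w) / n\<close> inside the hyperplane. Scaling up by \<open>n\<close> makes the two original heights appear,
  while the enlargement of the base shrinks to nothing, as \<open>F\<close> is compact.
\<close>
lemma measure_prism_shear_le:
  fixes F :: "'a::euclidean_space set"
  assumes F: "compact F" "F \<subseteq> {x. u \<bullet> x = h}" and w: "u \<bullet> w > 0" "u \<bullet> w' = u \<bullet> w"
  shows "measure lebesgue (prism F w') \<le> measure lebesgue (prism F w)"
proof -
  define r where "r n = 1 / real (Suc n)" for n
  define z where "z = w' - w"
  define G where "G n = prism F (r n *\<^sub>R z)" for n
  have uz: "u \<bullet> z = 0" using w by (simp add: z_def inner_simps)
  have r: "r n > 0" for n by (simp add: r_def)
  have G: "compact (G n)" "G n \<subseteq> {x. u \<bullet> x = h}" for n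
    using F compact_prism uz by (auto simp: G_def mem_prism inner_simps subset_iff)
  have le: "measure lebesgue (prism F w') \<le> measure lebesgue (prism (G n) w)" for n
  proof -
    have "prism F (r n *\<^sub>R w') \<subseteq> prism (G n) (r n *\<^sub>R w)"
    proof
      fix y assume "y \<in> prism F (r n *\<^sub>R w')"
      then obtain x t where x: "x \<in> F" "0 \<le> t" "t \<le> 1" "y = x + t *\<^sub>R (r n *\<^sub>R w')"
        by (auto simp: mem_prism)
      then have "x + t *\<^sub>R (r n *\<^sub>R z) \<in> G n" unfolding G_def mem_prism by blast
      moreover have "y = (x + t *\<^sub>R (r n *\<^sub>R z)) + t *\<^sub>R (r n *\<^sub>R w)"
        using x by (simp add: z_def algebra_simps)
      ultimately show "y \<in> prism (G n) (r n *\<^sub>R w)" using x unfolding mem_prism by blast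
    qed
    then have "measure lebesgue (prism F (r n *\<^sub>R w')) \<le> measure lebesgue (prism (G n) (r n *\<^sub>R w))"
      using F G by (intro measure_mono_fmeasurable fmeasurableD lmeasurable_prism) auto
    then show ?thesis
      using measure_prism_scaleR[OF F, of w' "r n"] measure_prism_scaleR[OF G, of w "r n"] r[of n] w
      by simp
  qed
  have dec: "decseq (\<lambda>n. prism (G n) w)"
  proof (rule decseq_SucI)
    fix n
    have "G (Suc n) \<subseteq> G n"
      unfolding G_def by (rule prism_mono) (auto simp: r_def frac_le)
    then show "prism (G (Suc n)) w \<subseteq> prism (G n) w"
      using prism_mono[of _ _ 1 1 w] by simp
  qed
  have "(\<Inter>n. prism (G n) w) = prism F w"
  proof (intro equalityI subsetI)
    fix y assume y: "y \<in> (\<Inter>n. prism (G n) w)"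
    \<comment> \<open>The height of \<open>y\<close> above the hyperplane fixes its parameter along \<open>w\<close>, so it is the same for all \<open>n\<close>.\<close>
    define t where "t = (u \<bullet> y - h) / (u \<bullet> w)"
    have ex: "\<exists>s. 0 \<le> s \<and> s \<le> 1 \<and> y - t *\<^sub>R w - s *\<^sub>R (r n *\<^sub>R z) \<in> F \<and> 0 \<le> t \<and> t \<le> 1" for n
    proof -
      from y have "y \<in> prism (G n) w" by blast
      then obtain x t' where x: "x \<in> G n" "0 \<le> t'" "t' \<le> 1" "y = x + t' *\<^sub>R w"
        by (auto simp: mem_prism)
      then have "t' = t" using G(2)[of n] w by (auto simp: t_def inner_simps)
      moreover from x obtain q s where "q \<in> F" "0 \<le> s" "s \<le> 1" "x = q + s *\<^sub>R (r n *\<^sub>R z)"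
        by (auto simp: G_def mem_prism)
      ultimately show ?thesis using x by (intro exI[of _ s]) auto
    qed
    then obtain s where s: "\<And>n. 0 \<le> s n \<and> s n \<le> 1 \<and> y - t *\<^sub>R w - s n *\<^sub>R (r n *\<^sub>R z) \<in> F"
      and t: "0 \<le> t" "t \<le> 1" by metis
    have "(\<lambda>n. s n * r n) \<longlonglongrightarrow> 0"
    proof (rule tendsto_sandwich[where f = "\<lambda>_. 0" and h = r])
      show "r \<longlonglongrightarrow> 0" unfolding r_def using LIMSEQ_Suc[OF lim_const_over_n[of 1]] by simp
      show "\<forall>\<^sub>F n in sequentially. 0 \<le> s n * r n" using s r by (simp add: less_imp_le)
      show "\<forall>\<^sub>F n in sequentially. s n * r n \<le> r n"
        using s r by (auto intro!: always_eventually mult_left_le_one_le less_imp_le)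
    qed auto
    then have "(\<lambda>n. y - t *\<^sub>R w - (s n * r n) *\<^sub>R z) \<longlonglongrightarrow> y - t *\<^sub>R w - 0 *\<^sub>R z"
      by (intro tendsto_intros)
    then have "y - t *\<^sub>R w - 0 *\<^sub>R z \<in> F"
      using s compact_imp_closed[OF F(1)] by (auto elim!: closed_sequentially[rotated 2])
    then show "y \<in> prism F w" using t by (auto simp: mem_prism intro!: bexI[of _ "y - t *\<^sub>R w"])
  next
    fix y assume "y \<in> prism F w"
    moreover have "F \<subseteq> G n" for n
    proof
      fix x assume "x \<in> F"
      then show "x \<in> G n" unfolding G_def mem_prism by (intro bexI[of _ x] exI[of _ 0]) auto
    qed
    ultimately have "y \<in> prism (G n) w" for n
      unfolding mem_prism by blast
    then show "y \<in> (\<Inter>n. prism (G n) w)" by blast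
  qed
  moreover have "(\<lambda>n. measure lebesgue (prism (G n) w)) \<longlonglongrightarrow> measure lebesgue (\<Inter>n. prism (G n) w)"
    using G(1) dec lmeasurable_prism
    by (intro Lim_measure_decseq) (auto simp: fmeasurable_def less_top[symmetric])
  ultimately show ?thesis
    using le by (auto intro: LIMSEQ_le_const)
qed

text \<open>
  The height of the oblique prism is \<open>u \<bullet> w\<close>: shear it upright and rescale the height to 1.
\<close>
lemma measure_prism:
  fixes F :: "'a::euclidean_space set"
  assumes F: "compact F" "F \<subseteq> {x. u \<bullet> x = h}" and u: "norm u = 1" and w: "u \<bullet> w > 0"
  shows "measure lebesgue (prism F w) = (u \<bullet> w) * measure lebesgue (prism F u)"
proof -
  have [simp]: "u \<bullet> u = 1" using u by (simp add: norm_eq_1)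
  have "measure lebesgue (prism F w) = measure lebesgue (prism F ((u \<bullet> w) *\<^sub>R u))"
    using w by (intro antisym measure_prism_shear_le[OF F]) auto
  also have "\<dots> = (u \<bullet> w) * measure lebesgue (prism F u)"
    using w by (intro measure_prism_scaleR[OF F]) auto
  finally show ?thesis .
qed

section \<open>The Minkowski relation\<close>

text \<open>
  Moving a polytope along \<open>w\<close> adds a region in front of it. Each point of that region lies on a line
  of direction \<open>w\<close> which leaves the polytope through a face with \<open>u i \<bullet> w > 0\<close>, and the exit point is
  unique; hence the region is the union of the prisms over these faces, with overlaps of measure 0.
  Some of the sets \<open>P \<inter> {x. u i \<bullet> x = h i}\<close> may be empty or of low dimension; they contribute \<open>0\<close>.
\<close>
lemma measure_prism_polyhedron:
  fixes u :: "'i \<Rightarrow> 'a::euclidean_space"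
  assumes I: "finite I" and inj: "inj_on u I" and nu: "\<And>i. i \<in> I \<Longrightarrow> norm (u i) = 1"
    and P: "compact P" "P = {x. \<forall>i\<in>I. u i \<bullet> x \<le> h i}"
  shows "measure lebesgue (prism P w) = measure lebesgue P +
           (\<Sum>i\<in>{i\<in>I. u i \<bullet> w > 0}. (u i \<bullet> w) * measure lebesgue (prism (P \<inter> {x. u i \<bullet> x = h i}) (u i)))"
proof -
  define J where "J = {i\<in>I. u i \<bullet> w > 0}"
  define F where "F i = P \<inter> {x. u i \<bullet> x = h i}" for i
  have F: "compact (F i)" "F i \<subseteq> {x. u i \<bullet> x = h i}" "F i \<subseteq> P" for i
    unfolding F_def using P(1) by (auto intro: compact_Int_closed closed_hyperplane)
  have J: "finite J" "J \<subseteq> I" using I by (auto simp: J_def)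
  have un: "prism P w = P \<union> (\<Union>i\<in>J. prism (F i) w)"
  proof (intro equalityI subsetI)
    fix y assume "y \<in> prism P w"
    then obtain p t where p: "p \<in> P" "0 \<le> t" "t \<le> 1" and y: "y = p + t *\<^sub>R w"
      by (auto simp: mem_prism)
    show "y \<in> P \<union> (\<Union>i\<in>J. prism (F i) w)"
    proof (cases "y \<in> P")
      case False
      \<comment> \<open>The inequality violated at \<open>y\<close> that is reached first, at time \<open>s i\<close>, gives the exit point \<open>q\<close>.\<close>
      define V where "V = {i\<in>I. u i \<bullet> y > h i}"
      define s where "s i = (h i - u i \<bullet> p) / (u i \<bullet> w)" for i
      have V: "finite V" "V \<noteq> {}" using False I by (auto simp: V_def P(2) not_le)
      have Vw: "u i \<bullet> w > 0" "s i \<ge> 0" "s i \<le> t" if "i \<in> V" for i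
      proof -
        have 1: "u i \<bullet> p \<le> h i" "h i < u i \<bullet> p + t * (u i \<bullet> w)"
          using that p by (auto simp: V_def y P(2) inner_simps)
        then have "t * (u i \<bullet> w) > 0" by linarith
        with p show "u i \<bullet> w > 0" by (simp add: zero_less_mult_iff)
        with 1 show "s i \<ge> 0" "s i \<le> t" by (auto simp: s_def field_simps)
      qed
      define i where "i = arg_min_on s V"
      have i: "i \<in> V" "\<And>j. j \<in> V \<Longrightarrow> s i \<le> s j"
        using arg_min_if_finite[OF V, of s] arg_min_least[OF V, of _ s] by (auto simp: i_def)
      define q where "q = p + s i *\<^sub>R w"
      have "u j \<bullet> q \<le> h j" if j: "j \<in> I" for j
      proof (cases "j \<in> V")
        case True
        then have "s i * (u j \<bullet> w) \<le> s j * (u j \<bullet> w)" using i Vw by (intro mult_right_mono) (auto intro: less_imp_le)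
        also have "\<dots> = h j - u j \<bullet> p" using Vw(1)[OF True] by (simp add: s_def)
        finally show ?thesis by (simp add: q_def inner_simps)
      next
        case False
        then have jy: "u j \<bullet> p + t * (u j \<bullet> w) \<le> h j" using j by (simp add: V_def y inner_simps)
        have jp: "u j \<bullet> p \<le> h j" using p j by (auto simp: P(2))
        show ?thesis
        proof (cases "u j \<bullet> w \<ge> 0")
          case True
          then have "s i * (u j \<bullet> w) \<le> t * (u j \<bullet> w)" using Vw[OF i(1)] by (intro mult_right_mono)
          then show ?thesis using jy by (simp add: q_def inner_simps)
        next
          case False
          then have "s i * (u j \<bullet> w) \<le> 0" using Vw[OF i(1)] by (simp add: mult_nonneg_nonpos)
          then show ?thesis using jp by (simp add: q_def inner_simps)
        qed
      qed
      moreover have "u i \<bullet> q = h i" using Vw(1)[OF i(1)] by (simp add: q_def s_def inner_simps)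
      ultimately have "q \<in> F i" by (auto simp: F_def P(2))
      moreover have "y = q + (t - s i) *\<^sub>R w" by (simp add: y q_def algebra_simps)
      moreover have "0 \<le> t - s i" "t - s i \<le> 1" using Vw[OF i(1)] p by auto
      ultimately have "y \<in> prism (F i) w" unfolding mem_prism by blast
      moreover have "i \<in> J" using i Vw[OF i(1)] by (auto simp: J_def V_def)
      ultimately show ?thesis by blast
    qed auto
  next
    fix y assume "y \<in> P \<union> (\<Union>i\<in>J. prism (F i) w)"
    then consider "y \<in> P" | i where "y \<in> prism (F i) w" by blast
    then show "y \<in> prism P w"
    proof cases
      case 1
      then show ?thesis unfolding mem_prism by (intro bexI[of _ y] exI[of _ 0]) auto
    next
      case (2 i)
      then show ?thesis using F(3)[of i] unfolding mem_prism by blast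
    qed
  qed
  have neg1: "negligible (P \<inter> prism (F i) w)" if "i \<in> J" for i
  proof (rule negligible_subset[OF negligible_hyperplane[of "u i" "h i"]])
    show "u i \<noteq> 0 \<or> h i \<noteq> 0" using that by (auto simp: J_def)
    show "P \<inter> prism (F i) w \<subseteq> {x. u i \<bullet> x = h i}"
    proof safe
      fix y assume y: "y \<in> P" "y \<in> prism (F i) w"
      then obtain q t where q: "q \<in> F i" "0 \<le> t" "y = q + t *\<^sub>R w" unfolding mem_prism by blast
      moreover have "u i \<bullet> y \<le> h i" using y that by (auto simp: J_def P(2))
      moreover have "t * (u i \<bullet> w) \<ge> 0" using q that by (simp add: J_def)
      ultimately show "u i \<bullet> y = h i" by (simp add: F_def inner_simps)
    qed
  qed
  have neg2: "negligible (prism (F i) w \<inter> prism (F j) w)" if ij: "i \<in> J" "j \<in> J" "i \<noteq> j" for i j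
  proof -
    \<comment> \<open>A common point has the same exit point for both faces; eliminating the time from the two
      equations of the faces puts it into a hyperplane, whose normal is nonzero as \<open>u i \<noteq> u j\<close>.\<close>
    let ?a = "(u j \<bullet> w) *\<^sub>R u i - (u i \<bullet> w) *\<^sub>R u j"
    let ?b = "(u j \<bullet> w) * h i - (u i \<bullet> w) * h j"
    have pos: "u i \<bullet> w > 0" "u j \<bullet> w > 0" using ij by (auto simp: J_def)
    have "?a \<noteq> 0"
    proof
      assume "?a = 0"
      then have eq: "(u j \<bullet> w) *\<^sub>R u i = (u i \<bullet> w) *\<^sub>R u j" by simp
      then have "norm ((u j \<bullet> w) *\<^sub>R u i) = norm ((u i \<bullet> w) *\<^sub>R u j)" by simp
      then have "u j \<bullet> w = u i \<bullet> w" using pos nu ij J by (simp add: subset_iff)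
      with eq have "(u i \<bullet> w) *\<^sub>R u i = (u i \<bullet> w) *\<^sub>R u j" by metis
      then have "u i = u j" using pos(1) by simp
      with inj ij J show False by (auto dest: inj_onD)
    qed
    moreover have "prism (F i) w \<inter> prism (F j) w \<subseteq> {x. ?a \<bullet> x = ?b}"
    proof (rule subsetI)
      fix y assume "y \<in> prism (F i) w \<inter> prism (F j) w"
      then have y: "y \<in> prism (F i) w" "y \<in> prism (F j) w" by blast+
      from y(1) obtain p s where p: "p \<in> F i" "y = p + s *\<^sub>R w" unfolding mem_prism by blast
      from y(2) obtain q t where q: "q \<in> F j" "y = q + t *\<^sub>R w" unfolding mem_prism by blast
      note pq = p q
      have i: "u i \<bullet> y = h i + s * (u i \<bullet> w)"
        using pq(1) unfolding pq(2) by (simp add: F_def inner_simps)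
      have j: "u j \<bullet> y = h j + t * (u j \<bullet> w)"
        using pq(3) unfolding pq(4) by (simp add: F_def inner_simps)
      have "p \<in> P" "q \<in> P" using pq(1,3) F(3) by blast+
      then have le: "u j \<bullet> p \<le> h j" "u i \<bullet> q \<le> h i" using ij J by (auto simp: P(2))
      have "p + s *\<^sub>R w = q + t *\<^sub>R w" using pq(2,4) by metis
      then have pe: "p = q + (t - s) *\<^sub>R w" and qe: "q = p + (s - t) *\<^sub>R w"
        by (simp_all add: algebra_simps)
      have "u j \<bullet> p = h j + (t - s) * (u j \<bullet> w)"
        using q(1) unfolding pe by (simp add: F_def inner_simps)
      moreover have "u i \<bullet> q = h i + (s - t) * (u i \<bullet> w)"
        using p(1) unfolding qe by (simp add: F_def inner_simps)
      ultimately have "(t - s) * (u j \<bullet> w) \<le> 0" "(s - t) * (u i \<bullet> w) \<le> 0"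
        using le by linarith+
      then have "s = t" using pos by (auto simp: mult_le_0_iff)
      then show "y \<in> {x. ?a \<bullet> x = ?b}" using i j by (simp add: inner_diff_left algebra_simps)
    qed
    ultimately show ?thesis
      by (intro negligible_subset[OF negligible_hyperplane[of ?a ?b]]) auto
  qed
  have meas: "prism (F i) w \<in> lmeasurable" for i using F(1) by (rule lmeasurable_prism)
  have "negligible (P \<inter> (\<Union>i\<in>J. prism (F i) w))"
    unfolding Int_UN_distrib by (rule negligible_Union) (use neg1 J in auto)
  then have "measure lebesgue (prism P w) = measure lebesgue P + measure lebesgue (\<Union>i\<in>J. prism (F i) w)"
    unfolding un using P(1) meas J
    by (subst measure_Un3) (auto simp: lmeasurable_compact negligible_imp_measure0 intro!: fmeasurable.finite_UN)
  also have "measure lebesgue (\<Union>i\<in>J. prism (F i) w) = (\<Sum>i\<in>J. measure lebesgue (prism (F i) w))"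
    using meas neg2 J by (intro measure_negligible_finite_Union_image) (auto simp: pairwise_def)
  also have "\<dots> = (\<Sum>i\<in>J. (u i \<bullet> w) * measure lebesgue (prism (F i) (u i)))"
    using nu by (intro sum.cong refl measure_prism[OF F(1) F(2)]) (auto simp: J_def)
  finally show ?thesis by (simp only: J_def F_def)
qed

text \<open>
  Moving the polytope along \<open>w\<close> or along \<open>- w\<close> sweeps translates of the same set, so the gains of volume
  in front agree. The gain for \<open>w\<close> comes from the faces with \<open>u i \<bullet> w > 0\<close>, that for \<open>- w\<close> from those
  with \<open>u i \<bullet> w < 0\<close>; their difference is the inner product of the sum with \<open>w\<close>.
\<close>
theorem minkowski_relation:
  fixes u :: "'i \<Rightarrow> 'a::euclidean_space"
  assumes I: "finite I" and inj: "inj_on u I" and nu: "\<And>i. i \<in> I \<Longrightarrow> norm (u i) = 1"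
    and P: "compact P" "P = {x. \<forall>i\<in>I. u i \<bullet> x \<le> h i}"
  shows "(\<Sum>i\<in>I. measure lebesgue (prism (P \<inter> {x. u i \<bullet> x = h i}) (u i)) *\<^sub>R u i) = 0"
proof -
  define m where "m i = measure lebesgue (prism (P \<inter> {x. u i \<bullet> x = h i}) (u i))" for i
  have "(\<Sum>i\<in>I. m i *\<^sub>R u i) \<bullet> w = 0" for w
  proof -
    have "(\<Sum>i\<in>{i\<in>I. u i \<bullet> w > 0}. (u i \<bullet> w) * m i) = (\<Sum>i\<in>{i\<in>I. u i \<bullet> (- w) > 0}. (u i \<bullet> (- w)) * m i)"
      using measure_prism_polyhedron[OF assms, of w]
        measure_prism_polyhedron[OF assms, of "- w", unfolded measure_prism_uminus]
      unfolding m_def by linarith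
    also have "\<dots> = - (\<Sum>i\<in>{i\<in>I. u i \<bullet> w < 0}. (u i \<bullet> w) * m i)"
      by (simp add: sum_negf)
    finally have "(\<Sum>i\<in>{i\<in>I. u i \<bullet> w > 0}. (u i \<bullet> w) * m i) + (\<Sum>i\<in>{i\<in>I. u i \<bullet> w < 0}. (u i \<bullet> w) * m i) = 0"
      by simp
    also have "(\<Sum>i\<in>{i\<in>I. u i \<bullet> w > 0}. (u i \<bullet> w) * m i) + (\<Sum>i\<in>{i\<in>I. u i \<bullet> w < 0}. (u i \<bullet> w) * m i)
       = (\<Sum>i\<in>{i\<in>I. u i \<bullet> w > 0} \<union> {i\<in>I. u i \<bullet> w < 0}. (u i \<bullet> w) * m i)"
      using I by (intro sum.union_disjoint[symmetric]) auto
    also have "\<dots> = (\<Sum>i\<in>I. (u i \<bullet> w) * m i)"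
      using I by (intro sum.mono_neutral_left) auto
    finally show ?thesis by (simp add: inner_sum_left mult.commute)
  qed
  then show ?thesis unfolding m_def using inner_eq_zero_iff by blast
qed

section \<open>Facets, supporting hyperplanes and edges\<close>

lemma polyhedron_separating_facet:
  fixes S :: "'a::euclidean_space set"
  assumes S: "polyhedron S" "aff_dim S = int DIM('a)" and x: "x \<notin> S"
  obtains a b where "a \<noteq> 0" "\<And>y. y \<in> S \<Longrightarrow> a \<bullet> y \<le> b" "a \<bullet> x > b"
    "affine hull (S \<inter> {y. a \<bullet> y = b}) = {y. a \<bullet> y = b}"
proof -
  obtain F where F: "finite F" "S = affine hull S \<inter> \<Inter>F"
    and ex: "\<forall>h\<in>F. \<exists>a b. a \<noteq> 0 \<and> h = {x. a \<bullet> x \<le> b}"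
    and min: "\<forall>F'. F' \<subset> F \<longrightarrow> S \<subset> affine hull S \<inter> \<Inter>F'"
    using S(1) polyhedron_Int_affine_minimal[of S] by meson
  from ex obtain a b where ab: "\<And>h. h \<in> F \<Longrightarrow> a h \<noteq> 0 \<and> h = {x. a h \<bullet> x \<le> b h}"
    by metis
  have "affine hull S = UNIV" using S(2) by (simp add: aff_dim_eq_full)
  with F(2) have SF: "S = \<Inter>F" by simp
  with x obtain h where h: "h \<in> F" "x \<notin> h" by blast
  let ?G = "S \<inter> {y. a h \<bullet> y = b h}"
  have "?G facet_of S"
    using facet_of_polyhedron_explicit[OF F ab] min h(1) by blast
  then have dim: "?G \<noteq> {}" "aff_dim ?G = int DIM('a) - 1"
    using S(2) by (auto simp: facet_of_def)
  have "affine hull ?G = {y. a h \<bullet> y = b h}"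
  proof (rule affine_dim_equal)
    show "affine hull ?G \<subseteq> {y. a h \<bullet> y = b h}"
      by (rule hull_minimal) (auto simp: affine_hyperplane)
    show "aff_dim (affine hull ?G) = aff_dim {y. a h \<bullet> y = b h}"
      using dim ab[OF h(1)] by simp
  qed (use dim in \<open>auto simp: affine_hyperplane\<close>)
  moreover have "a h \<bullet> y \<le> b h" if "y \<in> S" for y
  proof -
    have "y \<in> h" using that SF h(1) by blast
    then show ?thesis using ab[OF h(1)] by blast
  qed
  moreover have "a h \<bullet> x > b h"
    using h ab[OF h(1)] by (metis mem_Collect_eq not_le)
  ultimately show ?thesis using that ab[OF h(1)] by blast
qed

lemma convex_hull_Int_supporting_hyperplane:
  fixes X :: "'a::euclidean_space set"
  assumes X: "finite X" and le: "\<And>x. x \<in> X \<Longrightarrow> a \<bullet> x \<le> b"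
  shows "convex hull X \<inter> {x. a \<bullet> x = b} = convex hull (X \<inter> {x. a \<bullet> x = b})"
proof (rule antisym)
  have "convex hull X \<subseteq> {x. a \<bullet> x \<le> b}"
    using le by (intro hull_minimal) (auto simp: convex_halfspace_le)
  then have "(convex hull X \<inter> {x. a \<bullet> x = b}) face_of (convex hull X)"
    by (intro face_of_Int_supporting_hyperplane_le) auto
  from face_of_convex_hull_subset[OF finite_imp_compact[OF X] this]
  obtain X' where X': "X' \<subseteq> X" "convex hull X \<inter> {x. a \<bullet> x = b} = convex hull X'" by blast
  moreover have "X' \<subseteq> {x. a \<bullet> x = b}" using X'(2) hull_subset[of X' convex] by blast
  ultimately show "convex hull X \<inter> {x. a \<bullet> x = b} \<subseteq> convex hull (X \<inter> {x. a \<bullet> x = b})"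
    by (metis hull_mono le_inf_iff)
  show "convex hull (X \<inter> {x. a \<bullet> x = b}) \<subseteq> convex hull X \<inter> {x. a \<bullet> x = b}"
    by (rule hull_minimal)
       (auto intro: hull_inc convex_Int convex_hyperplane)
qed

lemma one_dimensional_line:
  fixes e :: "'a::euclidean_space set"
  assumes "aff_dim e = 1" "x \<in> e" "y \<in> e" "x \<noteq> y" "z \<in> e"
  obtains t where "z = x + t *\<^sub>R (y - x)"
proof -
  have "affine hull {x, y} = affine hull e"
  proof (rule affine_dim_equal)
    show "affine hull {x, y} \<subseteq> affine hull e" using assms by (intro hull_mono) auto
    show "aff_dim (affine hull {x, y}) = aff_dim (affine hull e)"
      using assms by (simp add: aff_dim_2)
  qed auto
  moreover have "z \<in> affine hull e" using assms(5) by (rule hull_inc)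
  ultimately have "z \<in> affine hull {x, y}" by simp
  then obtain s t where st: "s + t = 1" and z: "z = s *\<^sub>R x + t *\<^sub>R y"
    unfolding affine_hull_2 by blast
  have "s = 1 - t" using st by simp
  with z have "z = x + t *\<^sub>R (y - x)" by (simp only:) (simp add: algebra_simps)
  then show ?thesis by (rule that)
qed

lemma edge_ray:
  fixes e :: "'a::euclidean_space set"
  assumes "aff_dim e = 1" "v extreme_point_of e" "w \<in> e" "w \<noteq> v" "z \<in> e"
  obtains t where "t \<ge> 0" "z = v + t *\<^sub>R (w - v)"
proof -
  have v: "v \<in> e" using assms(2) by (simp add: extreme_point_of_def)
  obtain t where t: "z = v + t *\<^sub>R (w - v)"
    using one_dimensional_line[OF assms(1) v assms(3) _ assms(5)] assms(4) by metis
  have "t \<ge> 0"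
  proof (rule ccontr)
    assume "\<not> t \<ge> 0"
    then have t0: "t < 0" by simp
    define r where "r = - t / (1 - t)"
    have r: "0 < r" "r < 1" and tr: "(1 - r) * t + r = 0" using t0 by (auto simp: r_def field_simps)
    have "(1 - r) *\<^sub>R z + r *\<^sub>R w = v + ((1 - r) * t + r) *\<^sub>R (w - v)"
      unfolding t by (simp add: algebra_simps)
    then have "v = (1 - r) *\<^sub>R z + r *\<^sub>R w" unfolding tr by simp
    moreover have "z \<noteq> w"
    proof
      assume "z = w"
      then have "(t - 1) *\<^sub>R (w - v) = 0" unfolding t by (simp add: algebra_simps)
      with t0 assms(4) show False by simp
    qed
    ultimately have "v \<in> open_segment z w" using r unfolding in_segment by blast
    with assms show False by (auto simp: extreme_point_of_def)
  qed
  with t that show ?thesis by blast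
qed

lemma edge_unit_vector_eq:
  fixes e :: "'a::euclidean_space set"
  assumes "aff_dim e = 1" "v extreme_point_of e" "w \<in> e" "w \<noteq> v"
  shows "edge_unit_vector v e = (w - v) /\<^sub>R norm (w - v)"
  unfolding edge_unit_vector_def
proof (rule the_equality)
  fix u assume "\<exists>w\<in>e. w \<noteq> v \<and> u = (w - v) /\<^sub>R norm (w - v)"
  then obtain z where z: "z \<in> e" "z \<noteq> v" "u = (z - v) /\<^sub>R norm (z - v)" by blast
  obtain t where t: "t \<ge> 0" "z = v + t *\<^sub>R (w - v)"
    using edge_ray[OF assms z(1)] by blast
  with z(2) have "t > 0" by (auto simp: less_le)
  then show "u = (w - v) /\<^sub>R norm (w - v)" unfolding z(3) t(2) by simp
qed (use assms in blast)

text \<open>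
  One of the two unit vectors parallel to \<open>e\<close>. It is chosen once for the whole edge, so that a
  quantity computed from it belongs to the edge and not to one of its endpoints.
\<close>
definition edge_direction :: "'a::euclidean_space set \<Rightarrow> 'a" where
  "edge_direction e = (SOME u. norm u = 1 \<and> (\<forall>x\<in>e. \<forall>y\<in>e. \<exists>t. y - x = t *\<^sub>R u))"

lemma edge_direction:
  fixes e :: "'a::euclidean_space set"
  assumes e: "aff_dim e = 1"
  shows "norm (edge_direction e) = 1"
    and "x \<in> e \<Longrightarrow> y \<in> e \<Longrightarrow> \<exists>t. y - x = t *\<^sub>R edge_direction e"
proof -
  have "e \<noteq> {}" using e by auto
  then obtain p where p: "p \<in> e" by blast
  have "e \<noteq> {p}" using e by auto
  with p obtain q where q: "q \<in> e" "q \<noteq> p" by blast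
  let ?u = "(q - p) /\<^sub>R norm (q - p)"
  have "\<exists>t. y - x = t *\<^sub>R ?u" if x: "x \<in> e" and y: "y \<in> e" for x y
  proof -
    obtain s where s: "x = p + s *\<^sub>R (q - p)"
      using one_dimensional_line[OF e p q(1) _ x] q(2) by metis
    obtain t where t: "y = p + t *\<^sub>R (q - p)"
      using one_dimensional_line[OF e p q(1) _ y] q(2) by metis
    have "y - x = ((t - s) * norm (q - p)) *\<^sub>R ?u" using q(2) by (simp add: s t algebra_simps)
    then show ?thesis by blast
  qed
  then have "\<exists>u. norm u = 1 \<and> (\<forall>x\<in>e. \<forall>y\<in>e. \<exists>t. y - x = t *\<^sub>R u)"
    using q(2) by (intro exI[of _ ?u]) auto
  from someI_ex[OF this] show "norm (edge_direction e) = 1"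
    and "x \<in> e \<Longrightarrow> y \<in> e \<Longrightarrow> \<exists>t. y - x = t *\<^sub>R edge_direction e"
    unfolding edge_direction_def by blast+
qed

lemma edge_direction_edge_unit_vector:
  fixes e :: "'a::euclidean_space set"
  assumes "aff_dim e = 1" "v extreme_point_of e"
  shows "edge_direction e = edge_unit_vector v e \<or> edge_direction e = - edge_unit_vector v e"
proof -
  have v: "v \<in> e" using assms(2) by (simp add: extreme_point_of_def)
  have "e \<noteq> {v}" using assms(1) by auto
  with v obtain w where w: "w \<in> e" "w \<noteq> v" by blast
  obtain t where t: "w - v = t *\<^sub>R edge_direction e"
    using edge_direction(2)[OF assms(1) v w(1)] by blast
  then have "\<bar>t\<bar> = norm (w - v)" using edge_direction(1)[OF assms(1)] by simp
  moreover have "t \<noteq> 0" using t w by auto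
  ultimately show ?thesis
    unfolding edge_unit_vector_eq[OF assms w] t by (cases "t > 0") auto
qed

section \<open>Dual cells of a maximum of affine functions\<close>

text \<open>
  The function \<open>f\<close> is the maximum of the affine functions \<open>g C \<bullet> x + c C\<close>, and \<open>C\<close> is precisely the set
  where the one belonging to \<open>C\<close> attains the maximum. These properties, with
  local finiteness, are what the construction of the stress takes from a convex surface.
\<close>
locale max_affine_cells =
  fixes \<Delta> :: "'a::euclidean_space set set" and f :: "'a \<Rightarrow> real" and g :: "'a set \<Rightarrow> 'a" and c :: "'a set \<Rightarrow> real"
  assumes decomp: "cell_decomposition \<Delta>"
    and below: "\<And>C x. C \<in> \<Delta> \<Longrightarrow> g C \<bullet> x + c C \<le> f x"
    and cell_iff: "\<And>C x. C \<in> \<Delta> \<Longrightarrow> x \<in> C \<longleftrightarrow> f x = g C \<bullet> x + c C"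
    and locally_finite: "\<And>x. \<exists>U. open U \<and> x \<in> U \<and> finite {C\<in>\<Delta>. C \<inter> U \<noteq> {}}"
begin

text \<open>
  The face reciprocal to \<open>e\<close>: the subdifferential of \<open>f\<close> at the points of the relative interior of \<open>e\<close>,
  when \<open>e\<close> is a face of a cell.
\<close>
definition dual_cell :: "'a set \<Rightarrow> 'a set" where
  "dual_cell e = convex hull (g ` {C\<in>\<Delta>. e \<subseteq> C})"

lemma polyhedron_cell: "C \<in> \<Delta> \<Longrightarrow> polyhedron C"
  and cells_cover: "\<exists>C\<in>\<Delta>. x \<in> C"
  and cells_face: "C \<in> \<Delta> \<Longrightarrow> D \<in> \<Delta> \<Longrightarrow> (C \<inter> D) face_of C"
  using decomp unfolding cell_decomposition_def by blast+

lemma finite_cells_containing: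
  assumes "e \<noteq> {}"
  shows "finite {C\<in>\<Delta>. e \<subseteq> C}"
proof -
  obtain x where x: "x \<in> e" using assms by blast
  obtain U where U: "x \<in> U" "finite {C\<in>\<Delta>. C \<inter> U \<noteq> {}}" using locally_finite by blast
  show ?thesis by (rule finite_subset[OF _ U(2)]) (use x U(1) in blast)
qed

lemma compact_dual_cell: "e \<noteq> {} \<Longrightarrow> compact (dual_cell e)"
  unfolding dual_cell_def
  by (intro finite_imp_compact_convex_hull finite_imageI finite_cells_containing)

text \<open>
  Near \<open>x\<close> only the finitely many cells through \<open>x\<close> matter, so there \<open>f\<close> is \<open>f x\<close> plus the largest
  of their slopes in the direction of \<open>y - x\<close>.
\<close>
lemma mem_cell_if_steepest:
  obtains \<epsilon> where "\<epsilon> > 0"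
    "\<And>y C. \<lbrakk>y \<in> ball x \<epsilon>; C \<in> \<Delta>; x \<in> C;
       \<And>D. D \<in> \<Delta> \<Longrightarrow> x \<in> D \<Longrightarrow> g D \<bullet> (y - x) \<le> g C \<bullet> (y - x)\<rbrakk> \<Longrightarrow> y \<in> C"
proof -
  obtain U where U: "open U" "x \<in> U" "finite {C\<in>\<Delta>. C \<inter> U \<noteq> {}}" using locally_finite by blast
  let ?B = "{C\<in>\<Delta>. C \<inter> U \<noteq> {} \<and> x \<notin> C}"
  have "finite ?B" by (rule finite_subset[OF _ U(3)]) auto
  then have "closed (\<Union>?B)"
    by (intro closed_Union) (auto intro: polyhedron_imp_closed polyhedron_cell)
  then have "open (U - \<Union>?B)" using U(1) by (rule open_Diff[rotated])
  moreover have "x \<in> U - \<Union>?B" using U(2) by blast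
  ultimately obtain \<epsilon> where \<epsilon>: "\<epsilon> > 0" "ball x \<epsilon> \<subseteq> U - \<Union>?B" using openE by blast
  show ?thesis
  proof (rule that[OF \<epsilon>(1)])
    fix y C assume y: "y \<in> ball x \<epsilon>" and C: "C \<in> \<Delta>" "x \<in> C"
      and st: "\<And>D. D \<in> \<Delta> \<Longrightarrow> x \<in> D \<Longrightarrow> g D \<bullet> (y - x) \<le> g C \<bullet> (y - x)"
    obtain D where D: "D \<in> \<Delta>" "y \<in> D" using cells_cover by blast
    have "x \<in> D" using \<epsilon>(2) y D by blast
    then have "f y = f x + g D \<bullet> (y - x)" using D cell_iff by (simp add: inner_simps)
    also have "\<dots> \<le> f x + g C \<bullet> (y - x)" using st[OF D(1) \<open>x \<in> D\<close>] by simp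
    also have "\<dots> = g C \<bullet> y + c C" using C cell_iff by (simp add: inner_simps)
    finally show "y \<in> C" using below[OF C(1), of y] cell_iff[OF C(1)] by simp
  qed
qed

text \<open>
  Cells meet in common faces, and a face of \<open>D\<close> that contains a relatively interior point of \<open>e\<close>
  contains all of \<open>e\<close>.
\<close>
lemma face_within_cell:
  assumes D: "D \<in> \<Delta>" "e face_of D" and C: "C \<in> \<Delta>" and x: "x \<in> rel_interior e" "x \<in> C"
  shows "e \<subseteq> C" and "e face_of C"
proof -
  have eD: "e \<subseteq> D" by (rule face_of_imp_subset[OF D(2)])
  have "x \<in> D" using x(1) eD rel_interior_subset by blast
  with x have "(D \<inter> C) \<inter> rel_interior e \<noteq> {}" by blast
  from subset_of_face_of[OF cells_face[OF D(1) C] eD this] show "e \<subseteq> C" by blast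
  then have "e face_of (C \<inter> D)" by (intro face_of_subset[OF D(2)]) (use eD in auto)
  from face_of_trans[OF this cells_face[OF C D(1)]] show "e face_of C" .
qed

lemma extreme_point_of_cell:
  assumes "D \<in> \<Delta>" "v extreme_point_of D" "C \<in> \<Delta>" "v \<in> C"
  shows "v extreme_point_of C"
  using face_within_cell(2)[of D "{v}" C v] assms by (simp add: face_of_singleton)

text \<open>
  The link between dimensions of faces and of dual cells: if the dual cell of \<open>e\<close> lies in a hyperplane
  with normal \<open>a\<close>, then moving from \<open>x\<close> along \<open>a\<close> or \<open>- a\<close> changes all affine functions that are
  maximal at \<open>x\<close> by the same amount. They stay maximal, so the motion stays in every cell around \<open>x\<close>
  and, by the definition of a face, in \<open>e\<close>.
\<close>
lemma constant_slope_tangent: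
  assumes D: "D \<in> \<Delta>" "e face_of D" and x: "x \<in> rel_interior e"
    and a: "\<And>C. C \<in> \<Delta> \<Longrightarrow> e \<subseteq> C \<Longrightarrow> a \<bullet> g C = b"
  obtains t where "t > 0" "x + t *\<^sub>R a \<in> e"
proof (cases "a = 0")
  case True
  then show ?thesis using that[of 1] x rel_interior_subset by auto
next
  case False
  have eD: "e \<subseteq> D" by (rule face_of_imp_subset[OF D(2)])
  have xD: "x \<in> D" "x \<in> e" using x eD rel_interior_subset by blast+
  have a': "g C \<bullet> a = b" if "C \<in> \<Delta>" "x \<in> C" for C
    using a[OF that(1) face_within_cell(1)[OF D that(1) x that(2)]] by (simp add: inner_commute)
  obtain \<epsilon> where \<epsilon>: "\<epsilon> > 0"
    "\<And>y C. \<lbrakk>y \<in> ball x \<epsilon>; C \<in> \<Delta>; x \<in> C;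
       \<And>D. D \<in> \<Delta> \<Longrightarrow> x \<in> D \<Longrightarrow> g D \<bullet> (y - x) \<le> g C \<bullet> (y - x)\<rbrakk> \<Longrightarrow> y \<in> C"
    using mem_cell_if_steepest[of x] by blast
  define t where "t = \<epsilon> / (2 * norm a)"
  have t: "t > 0" "t * norm a < \<epsilon>" using \<epsilon>(1) False by (auto simp: t_def)
  have in_D: "x + s *\<^sub>R a \<in> D" if "\<bar>s\<bar> = t" for s
    by (rule \<epsilon>(2)[OF _ D(1) xD(1)]) (use t that D(1) xD(1) a' in \<open>auto simp: dist_norm\<close>)
  have "x \<in> open_segment (x - t *\<^sub>R a) (x + t *\<^sub>R a)"
    using t False unfolding in_segment
    by (intro conjI exI[of _ "1/2"]) (auto simp: algebra_simps scaleR_add_left[symmetric])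
  then have "x + t *\<^sub>R a \<in> e"
    using D(2) in_D[of t] in_D[of "- t"] t(1) xD(2) unfolding face_of_def
    by (simp add: algebra_simps) blast
  with t that show ?thesis by blast
qed

text \<open>
  Otherwise a normal of a hyperplane containing the dual cell would be a direction in which one can
  move within the face \<open>{v}\<close>.
\<close>
lemma dual_vertex_full_dimensional:
  assumes v: "v \<in> skeleton_vertices \<Delta>"
  shows "aff_dim (dual_cell {v}) = int DIM('a)"
proof -
  obtain D where D: "D \<in> \<Delta>" "v extreme_point_of D" using v by (auto simp: skeleton_vertices_def)
  have "interior (dual_cell {v}) \<noteq> {}"
  proof
    assume "interior (dual_cell {v}) = {}"
    then obtain a b where ab: "a \<noteq> 0" "dual_cell {v} \<subseteq> {x. a \<bullet> x = b}"
      using empty_interior_subset_hyperplane[of "dual_cell {v}"] by (auto simp: dual_cell_def)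
    have eq: "a \<bullet> g C = b" if "C \<in> \<Delta>" "{v} \<subseteq> C" for C
    proof -
      have "g C \<in> dual_cell {v}" unfolding dual_cell_def using that by (intro hull_inc) auto
      with ab show ?thesis by blast
    qed
    obtain t where "t > 0" "v + t *\<^sub>R a \<in> {v}"
      by (rule constant_slope_tangent[OF D(1), of "{v}" v a b]) (use D eq in \<open>auto simp: face_of_singleton\<close>)
    with ab show False by simp
  qed
  then show ?thesis
    by (rule aff_dim_nonempty_interior)
qed

definition dual_volume :: "'a set \<Rightarrow> real" where
  "dual_volume e = measure lebesgue (prism (dual_cell e) (edge_direction e))"

text \<open>
  A flat prism over the dual cell would lie in a hyperplane whose normal \<open>a\<close> is orthogonal to the edge,
  because the prism extends in the direction of the edge; but constancy of \<open>a \<bullet> g C\<close> on the cells around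
  the edge allows a motion along \<open>a\<close> within the edge.
\<close>
lemma dual_edge_volume_pos:
  assumes e: "e \<in> skeleton_edges \<Delta>"
  shows "dual_volume e > 0"
proof -
  obtain D where D: "D \<in> \<Delta>" "e face_of D" and dim: "aff_dim e = 1"
    using e by (auto simp: skeleton_edges_def edge_of_def)
  let ?u = "edge_direction e" and ?Q = "prism (dual_cell e) (edge_direction e)"
  have "convex e" using D(2) by (rule face_of_imp_convex)
  moreover have ne: "e \<noteq> {}" using dim by auto
  ultimately obtain x where x: "x \<in> rel_interior e" using rel_interior_eq_empty by blast
  have conv: "convex ?Q" by (intro convex_prism) (simp add: dual_cell_def)
  have "interior ?Q \<noteq> {}"
  proof
    assume "interior ?Q = {}"
    then obtain a b where ab: "a \<noteq> 0" "?Q \<subseteq> {x. a \<bullet> x = b}"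
      using empty_interior_subset_hyperplane[OF conv] by blast
    have ends: "p \<in> ?Q" "p + ?u \<in> ?Q" if "p \<in> dual_cell e" for p
    proof -
      have "p + 0 *\<^sub>R ?u \<in> ?Q" using that unfolding mem_prism by (intro bexI[of _ p] exI[of _ 0]) auto
      moreover have "p + 1 *\<^sub>R ?u \<in> ?Q" using that unfolding mem_prism by (intro bexI[of _ p] exI[of _ 1]) auto
      ultimately show "p \<in> ?Q" "p + ?u \<in> ?Q" by simp_all
    qed
    have gC: "g C \<in> dual_cell e" if "C \<in> \<Delta>" "e \<subseteq> C" for C
      unfolding dual_cell_def using that by (intro hull_inc) auto
    have eq: "a \<bullet> g C = b" if "C \<in> \<Delta>" "e \<subseteq> C" for C
      using ends(1)[OF gC[OF that]] ab by blast
    have "a \<bullet> (g D + ?u) = b"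
      using ends(2)[OF gC[OF D(1)]] face_of_imp_subset[OF D(2)] ab by blast
    then have au: "a \<bullet> ?u = 0"
      using eq[OF D(1)] face_of_imp_subset[OF D(2)] by (simp add: inner_simps)
    obtain t where t: "t > 0" "x + t *\<^sub>R a \<in> e"
      using constant_slope_tangent[OF D x eq] by blast
    obtain s where "x + t *\<^sub>R a - x = s *\<^sub>R ?u"
      using edge_direction(2)[OF dim _ t(2), of x] x rel_interior_subset by blast
    then have "t *\<^sub>R a = s *\<^sub>R ?u" by simp
    then have "t * (a \<bullet> a) = s * (a \<bullet> ?u)" by (metis inner_scaleR_right)
    with t ab au show False by simp
  qed
  then have "\<not> negligible ?Q" using negligible_convex_interior[OF conv] by simp
  then show ?thesis
    using lmeasurable_prism[OF compact_dual_cell[OF ne], of ?u]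
    by (simp add: dual_volume_def negligible_iff_measure zero_less_measure_iff)
qed

section \<open>The polytope dual to a vertex\<close>

lemma edge_containing_cell:
  assumes "e \<in> skeleton_edges \<Delta>"
  obtains D where "D \<in> \<Delta>" "e face_of D" "aff_dim e = 1" "e \<subseteq> D"
  using assms face_of_imp_subset by (auto simp: skeleton_edges_def edge_of_def)

text \<open>
  The directional derivative of \<open>f\<close> at \<open>v\<close> along \<open>e\<close>. The gradients of all cells containing \<open>e\<close> have the
  same component along \<open>e\<close>, so any of these cells may be chosen.
\<close>
definition edge_slope :: "'a \<Rightarrow> 'a set \<Rightarrow> real" where
  "edge_slope v e = edge_unit_vector v e \<bullet> g (SOME D. D \<in> \<Delta> \<and> e \<subseteq> D)"

text \<open>
  The affine function of \<open>C\<close> agrees with \<open>f\<close> at \<open>v\<close> and is at most \<open>f\<close> at a relatively interior point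
  \<open>x\<close> of \<open>e\<close>; comparing the two values at \<open>x\<close> compares the slopes, and equality means \<open>x \<in> C\<close>.
\<close>
lemma slope_along_edge:
  assumes e: "e \<in> incident_edges (skeleton_edges \<Delta>) v" and C: "C \<in> \<Delta>" "v \<in> C"
  shows "edge_unit_vector v e \<bullet> g C \<le> edge_slope v e"
    and "edge_unit_vector v e \<bullet> g C = edge_slope v e \<longleftrightarrow> e \<subseteq> C"
proof -
  let ?u = "edge_unit_vector v e"
  obtain D where D: "D \<in> \<Delta>" "e face_of D" "aff_dim e = 1" "e \<subseteq> D" and v: "v extreme_point_of e"
    using e edge_containing_cell by (auto simp: incident_edges_def)
  define B where "B = (SOME D. D \<in> \<Delta> \<and> e \<subseteq> D)"
  have B: "B \<in> \<Delta>" "e \<subseteq> B" using someI[of "\<lambda>D. D \<in> \<Delta> \<and> e \<subseteq> D" D] D unfolding B_def by auto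
  have "e \<noteq> {}" using D(3) by auto
  then obtain x where x: "x \<in> rel_interior e"
    using rel_interior_eq_empty face_of_imp_convex[OF D(2)] by blast
  then have xe: "x \<in> e" using rel_interior_subset by blast
  have "e \<noteq> {v}" using D(3) by auto
  with x v have xv: "x \<noteq> v" using extreme_point_not_in_REL_INTERIOR by blast
  have ve: "v \<in> e" using v by (simp add: extreme_point_of_def)
  define n where "n = norm (x - v)"
  have n: "n > 0" using xv by (simp add: n_def)
  have u: "?u = (x - v) /\<^sub>R n" unfolding n_def by (rule edge_unit_vector_eq[OF D(3) v xe xv])
  have xeq: "x = v + n *\<^sub>R ?u" using n by (simp add: u)
  have fx: "f x = f v + n * edge_slope v e"
  proof -
    have "f x = g B \<bullet> x + c B" "f v = g B \<bullet> v + c B" using cell_iff[OF B(1)] B(2) xe ve by blast+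
    then show ?thesis
      unfolding edge_slope_def B_def[symmetric]
      using arg_cong[OF xeq, of "\<lambda>x. g B \<bullet> x"] by (simp add: inner_simps inner_commute)
  qed
  have Cx: "g C \<bullet> x + c C = f v + n * (?u \<bullet> g C)"
    using cell_iff[OF C(1), of v] C(2) arg_cong[OF xeq, of "\<lambda>x. g C \<bullet> x"]
    by (simp add: inner_simps inner_commute)
  show "?u \<bullet> g C \<le> edge_slope v e"
    using below[OF C(1), of x] n unfolding Cx fx by simp
  have "?u \<bullet> g C = edge_slope v e \<longleftrightarrow> x \<in> C"
    unfolding cell_iff[OF C(1)] Cx fx using n by auto
  also have "x \<in> C \<longleftrightarrow> e \<subseteq> C"
    using face_within_cell(1)[OF D(1,2) C(1) x] xe by blast
  finally show "?u \<bullet> g C = edge_slope v e \<longleftrightarrow> e \<subseteq> C" .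
qed

lemma dual_edge_face_of_dual_vertex:
  assumes e: "e \<in> incident_edges (skeleton_edges \<Delta>) v"
  shows "dual_cell e = dual_cell {v} \<inter> {p. edge_unit_vector v e \<bullet> p = edge_slope v e}"
proof -
  have ve: "v \<in> e" using e by (auto simp: incident_edges_def extreme_point_of_def)
  have "dual_cell {v} \<inter> {p. edge_unit_vector v e \<bullet> p = edge_slope v e} =
        convex hull (g ` {C \<in> \<Delta>. {v} \<subseteq> C} \<inter> {p. edge_unit_vector v e \<bullet> p = edge_slope v e})"
    unfolding dual_cell_def
    by (rule convex_hull_Int_supporting_hyperplane)
       (use slope_along_edge(1)[OF e] finite_cells_containing[of "{v}"] in auto)
  also have "g ` {C \<in> \<Delta>. {v} \<subseteq> C} \<inter> {p. edge_unit_vector v e \<bullet> p = edge_slope v e} = g ` {C\<in>\<Delta>. e \<subseteq> C}"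
    using slope_along_edge(2)[OF e] ve by blast
  finally show ?thesis by (simp add: dual_cell_def)
qed

text \<open>
  Every facet of the dual polytope of \<open>v\<close> comes from an edge at \<open>v\<close>. The edge is the intersection of
  the cells whose gradients lie on the facet. It contains a short segment from \<open>v\<close> in the direction of
  the normal \<open>a\<close>, since these cells are steepest in that direction. It lies in the line through \<open>v\<close>
  in this direction: if \<open>y\<close> is one of its points, all these gradients have the same inner product with
  \<open>y - v\<close>, and as they span the hyperplane of the facet, \<open>y - v\<close> is a multiple of \<open>a\<close>.
\<close>
lemma edge_of_dual_facet:
  assumes v: "v \<in> skeleton_vertices \<Delta>" and a: "a \<noteq> 0"
    and le: "\<And>p. p \<in> dual_cell {v} \<Longrightarrow> a \<bullet> p \<le> b"
    and facet: "affine hull (dual_cell {v} \<inter> {p. a \<bullet> p = b}) = {p. a \<bullet> p = b}"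
  obtains e where "e \<in> incident_edges (skeleton_edges \<Delta>) v"
    "edge_unit_vector v e = a /\<^sub>R norm a" "edge_slope v e = b / norm a"
proof -
  define A where "A = {C\<in>\<Delta>. v \<in> C \<and> a \<bullet> g C = b}"
  have g_le: "a \<bullet> g C \<le> b" if "C \<in> \<Delta>" "v \<in> C" for C
    by (rule le) (use that in \<open>auto simp: dual_cell_def intro: hull_inc\<close>)
  have hullA: "dual_cell {v} \<inter> {p. a \<bullet> p = b} = convex hull (g ` A)"
  proof -
    have "dual_cell {v} \<inter> {p. a \<bullet> p = b} = convex hull (g ` {C \<in> \<Delta>. {v} \<subseteq> C} \<inter> {p. a \<bullet> p = b})"
      unfolding dual_cell_def
      by (rule convex_hull_Int_supporting_hyperplane)
         (use g_le finite_cells_containing[of "{v}"] in auto)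
    also have "g ` {C \<in> \<Delta>. {v} \<subseteq> C} \<inter> {p. a \<bullet> p = b} = g ` A" by (auto simp: A_def)
    finally show ?thesis .
  qed
  have "{p. a \<bullet> p = b} \<noteq> {}" using hyperplane_eq_empty[of a b] a by blast
  then have "A \<noteq> {}" using facet hullA by auto
  then obtain C0 where C0: "C0 \<in> A" by blast
  then have C0': "C0 \<in> \<Delta>" "v \<in> C0" "a \<bullet> g C0 = b" by (auto simp: A_def)
  define e where "e = \<Inter>A"
  have ve: "v \<in> e" by (auto simp: e_def A_def)
  have "\<Inter>((\<inter>) C0 ` A) face_of C0"
    by (rule face_of_Inter) (use C0 in \<open>auto simp: A_def cells_face\<close>)
  moreover have "\<Inter>((\<inter>) C0 ` A) = e" using C0 by (auto simp: e_def)
  ultimately have eface: "e face_of C0" by simp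
  obtain \<epsilon> where \<epsilon>: "\<epsilon> > 0"
    "\<And>y C. \<lbrakk>y \<in> ball v \<epsilon>; C \<in> \<Delta>; v \<in> C;
       \<And>D. D \<in> \<Delta> \<Longrightarrow> v \<in> D \<Longrightarrow> g D \<bullet> (y - v) \<le> g C \<bullet> (y - v)\<rbrakk> \<Longrightarrow> y \<in> C"
    using mem_cell_if_steepest[of v] by blast
  define t where "t = \<epsilon> / (2 * norm a)"
  have t: "t > 0" "t * norm a < \<epsilon>" using \<epsilon>(1) a by (auto simp: t_def)
  have w: "v + t *\<^sub>R a \<in> e"
    unfolding e_def
  proof
    fix C assume "C \<in> A"
    then have C: "C \<in> \<Delta>" "v \<in> C" "a \<bullet> g C = b" by (auto simp: A_def)
    show "v + t *\<^sub>R a \<in> C"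
    proof (rule \<epsilon>(2)[OF _ C(1,2)])
      show "v + t *\<^sub>R a \<in> ball v \<epsilon>" using t by (simp add: dist_norm)
      show "g D \<bullet> (v + t *\<^sub>R a - v) \<le> g C \<bullet> (v + t *\<^sub>R a - v)" if "D \<in> \<Delta>" "v \<in> D" for D
        using g_le[OF that] C(3) t(1) by (simp add: inner_commute)
    qed
  qed
  have line: "y \<in> affine hull {v, v + t *\<^sub>R a}" if y: "y \<in> e" for y
  proof -
    let ?k = "f y - f v"
    have "(y - v) \<bullet> g C = ?k" if "C \<in> A" for C
    proof -
      have "y \<in> C" "v \<in> C" "C \<in> \<Delta>" using that y by (auto simp: e_def A_def)
      then show ?thesis using cell_iff[of C] by (simp add: inner_simps inner_commute)
    qed
    then have "affine hull (g ` A) \<subseteq> {p. (y - v) \<bullet> p = ?k}"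
      by (intro hull_minimal) (auto simp: affine_hyperplane)
    then have sub: "{p. a \<bullet> p = b} \<subseteq> {p. (y - v) \<bullet> p = ?k}"
      using facet by (simp add: hullA affine_hull_convex_hull)
    \<comment> \<open>The component \<open>z\<close> of \<open>y - v\<close> orthogonal to \<open>a\<close> can be added to \<open>g C0\<close> without leaving the hyperplane.\<close>
    define s where "s = ((y - v) \<bullet> a) / (a \<bullet> a)"
    define z where "z = y - v - s *\<^sub>R a"
    have az: "a \<bullet> z = 0" using a by (simp add: z_def s_def inner_simps inner_commute)
    then have "a \<bullet> (g C0 + z) = b" using C0'(3) by (simp add: inner_simps)
    then have "(y - v) \<bullet> (g C0 + z) = ?k" "(y - v) \<bullet> g C0 = ?k" using sub C0'(3) by blast+
    then have "(y - v) \<bullet> z = 0" by (simp add: inner_right_distrib)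
    moreover have "z \<bullet> z = (y - v) \<bullet> z - s * (a \<bullet> z)"
      by (subst (1) z_def) (simp only: inner_diff_left inner_scaleR_left)
    ultimately have "z \<bullet> z = 0" using az by simp
    then have "z = 0" by simp
    then have "y = v + (s / t) *\<^sub>R (t *\<^sub>R a)" using t(1) by (simp add: z_def algebra_simps)
    also have "\<dots> = (1 - s / t) *\<^sub>R v + (s / t) *\<^sub>R (v + t *\<^sub>R a)" by (simp add: algebra_simps)
    finally show ?thesis unfolding affine_hull_2 by force
  qed
  have wv: "v + t *\<^sub>R a \<noteq> v" using t a by simp
  have "aff_dim e \<le> aff_dim {v, v + t *\<^sub>R a}"
    using aff_dim_subset[OF subsetI[OF line]] by (simp only: aff_dim_affine_hull)
  moreover have "aff_dim {v, v + t *\<^sub>R a} \<le> aff_dim e"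
    using ve w by (intro aff_dim_subset) auto
  ultimately have dim: "aff_dim e = 1" using wv by (simp add: aff_dim_2)
  obtain D where "D \<in> \<Delta>" "v extreme_point_of D" using v by (auto simp: skeleton_vertices_def)
  from extreme_point_of_cell[OF this C0'(1,2)] have "v extreme_point_of C0" .
  then have ext: "v extreme_point_of e" using extreme_point_of_face[OF eface] ve by blast
  then have inc: "e \<in> incident_edges (skeleton_edges \<Delta>) v"
    using C0'(1) eface dim by (auto simp: incident_edges_def skeleton_edges_def edge_of_def)
  have u: "edge_unit_vector v e = a /\<^sub>R norm a"
    using edge_unit_vector_eq[OF dim ext w wv] t(1) by simp
  have "e \<subseteq> C0" using eface by (rule face_of_imp_subset)
  then have "edge_slope v e = b / norm a"
    using slope_along_edge(2)[OF inc C0'(1,2)] C0'(3) u by (simp add: divide_inverse mult.commute)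
  with inc u that show ?thesis by blast
qed

text \<open>
  A point outside the dual polytope violates the inequality of some facet, and this inequality is,
  up to normalisation, the one belonging to an edge.
\<close>
lemma dual_vertex_eq_edge_halfspaces:
  assumes v: "v \<in> skeleton_vertices \<Delta>"
  shows "dual_cell {v} =
    {p. \<forall>e\<in>incident_edges (skeleton_edges \<Delta>) v. edge_unit_vector v e \<bullet> p \<le> edge_slope v e}"
    (is "_ = ?H")
proof (intro equalityI subsetI)
  fix p assume p: "p \<in> dual_cell {v}"
  show "p \<in> ?H"
  proof (intro CollectI ballI)
    fix e assume e: "e \<in> incident_edges (skeleton_edges \<Delta>) v"
    have "dual_cell {v} \<subseteq> {p. edge_unit_vector v e \<bullet> p \<le> edge_slope v e}"
      unfolding dual_cell_def using slope_along_edge(1)[OF e]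
      by (intro hull_minimal) (auto simp: convex_halfspace_le)
    with p show "edge_unit_vector v e \<bullet> p \<le> edge_slope v e" by blast
  qed
next
  fix p assume p: "p \<in> ?H"
  show "p \<in> dual_cell {v}"
  proof (rule ccontr)
    assume np: "p \<notin> dual_cell {v}"
    have poly: "polyhedron (dual_cell {v})"
      unfolding dual_cell_def by (intro polyhedron_convex_hull finite_imageI finite_cells_containing) simp
    obtain a b where ab: "a \<noteq> 0" "\<And>y. y \<in> dual_cell {v} \<Longrightarrow> a \<bullet> y \<le> b" "a \<bullet> p > b"
      "affine hull (dual_cell {v} \<inter> {y. a \<bullet> y = b}) = {y. a \<bullet> y = b}"
      using polyhedron_separating_facet[OF poly dual_vertex_full_dimensional[OF v] np] by blast
    obtain e where "e \<in> incident_edges (skeleton_edges \<Delta>) v"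
      "edge_unit_vector v e = a /\<^sub>R norm a" "edge_slope v e = b / norm a"
      using edge_of_dual_facet[OF v ab(1,2,4)] by blast
    with p have "(a /\<^sub>R norm a) \<bullet> p \<le> b / norm a" by force
    with ab(1,3) show False by (simp add: divide_simps)
  qed
qed

lemma finite_incident_edges: "finite (incident_edges (skeleton_edges \<Delta>) v)"
proof (rule finite_subset)
  show "incident_edges (skeleton_edges \<Delta>) v \<subseteq> (\<Union>C\<in>{C\<in>\<Delta>. {v} \<subseteq> C}. {F. F face_of C})"
  proof
    fix e assume "e \<in> incident_edges (skeleton_edges \<Delta>) v"
    then have "e \<in> skeleton_edges \<Delta>" "v \<in> e" by (auto simp: incident_edges_def extreme_point_of_def)
    then show "e \<in> (\<Union>C\<in>{C\<in>\<Delta>. {v} \<subseteq> C}. {F. F face_of C})"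
      using edge_containing_cell[of e] by blast
  qed
  show "finite (\<Union>C\<in>{C\<in>\<Delta>. {v} \<subseteq> C}. {F. F face_of C})"
    using finite_cells_containing[of "{v}"] by (auto intro: finite_polyhedron_faces polyhedron_cell)
qed

lemma norm_edge_unit_vector:
  assumes "e \<in> incident_edges (skeleton_edges \<Delta>) v"
  shows "norm (edge_unit_vector v e) = 1"
proof -
  have e: "aff_dim e = 1" "v extreme_point_of e"
    using assms by (auto simp: incident_edges_def skeleton_edges_def edge_of_def)
  show ?thesis using edge_direction_edge_unit_vector[OF e] edge_direction(1)[OF e(1)] by auto
qed

text \<open>
  The edge \<open>e\<close> is a face of every cell through \<open>x\<close>, in particular of a cell with the face \<open>e'\<close>. Hence
  it lies in \<open>e'\<close>, as a face of the same dimension.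
\<close>
lemma edges_meeting_in_interior_eq:
  assumes e: "e \<in> skeleton_edges \<Delta>" and e': "e' \<in> skeleton_edges \<Delta>"
    and x: "x \<in> rel_interior e" "x \<in> e'"
  shows "e = e'"
proof -
  obtain D where D: "D \<in> \<Delta>" "e face_of D" "aff_dim e = 1" by (rule edge_containing_cell[OF e])
  obtain D' where D': "D' \<in> \<Delta>" "e' face_of D'" "aff_dim e' = 1" "e' \<subseteq> D'"
    by (rule edge_containing_cell[OF e'])
  have "e \<subseteq> D'" and eD': "e face_of D'"
    using face_within_cell[OF D(1,2) D'(1) x(1)] x(2) D'(4) by blast+
  then have "e \<subseteq> e'" using subset_of_face_of[OF D'(2), of e] x by blast
  then have "e face_of e'" by (rule face_of_subset[OF eD' _ D'(4)])
  then show "e = e'"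
    using face_of_aff_dim_lt[OF face_of_imp_convex[OF D'(2)]] D(3) D'(3) by fastforce
qed

text \<open>
  Two edges that leave \<open>v\<close> in the same direction overlap: of two points chosen in their relative
  interiors, the one closer to \<open>v\<close> belongs to both edges.
\<close>
lemma inj_on_edge_unit_vector: "inj_on (edge_unit_vector v) (incident_edges (skeleton_edges \<Delta>) v)"
proof (rule inj_onI)
  fix e e' assume e: "e \<in> incident_edges (skeleton_edges \<Delta>) v"
    and e': "e' \<in> incident_edges (skeleton_edges \<Delta>) v"
    and eq: "edge_unit_vector v e = edge_unit_vector v e'"
  have pt: "\<exists>n>0. v + n *\<^sub>R edge_unit_vector v e \<in> rel_interior e \<and> v \<in> e \<and> convex e"
    if e: "e \<in> incident_edges (skeleton_edges \<Delta>) v" for e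
  proof -
    obtain D where D: "D \<in> \<Delta>" "e face_of D" "aff_dim e = 1" and v: "v extreme_point_of e"
      using e edge_containing_cell[of e] unfolding incident_edges_def by blast
    have conv: "convex e" by (rule face_of_imp_convex[OF D(2)])
    have "e \<noteq> {}" "e \<noteq> {v}" using D(3) by auto
    then obtain x where x: "x \<in> rel_interior e" "x \<noteq> v"
      using rel_interior_eq_empty[OF conv] extreme_point_not_in_REL_INTERIOR[OF v] by blast
    then have xe: "x \<in> e" using rel_interior_subset by blast
    have "x = v + norm (x - v) *\<^sub>R edge_unit_vector v e"
      using edge_unit_vector_eq[OF D(3) v xe x(2)] x(2) by simp
    then show ?thesis
      using x v conv by (intro exI[of _ "norm (x - v)"]) (simp add: extreme_point_of_def)
  qed
  obtain n where n: "n > 0" "v + n *\<^sub>R edge_unit_vector v e \<in> rel_interior e" "v \<in> e" "convex e"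
    using pt[OF e] by blast
  obtain n' where n': "n' > 0" "v + n' *\<^sub>R edge_unit_vector v e' \<in> rel_interior e'" "v \<in> e'" "convex e'"
    using pt[OF e'] by blast
  have seg: "v + r *\<^sub>R u \<in> d" if "convex d" "v \<in> d" "v + s *\<^sub>R u \<in> d" "0 < r" "r \<le> s" for r s u d
  proof -
    have "(1 - r / s) *\<^sub>R v + (r / s) *\<^sub>R (v + s *\<^sub>R u) \<in> d"
      using that by (intro convexD_alt) auto
    moreover have "(1 - r / s) *\<^sub>R v + (r / s) *\<^sub>R (v + s *\<^sub>R u) = v + r *\<^sub>R u"
      using that(4,5) by (simp add: algebra_simps)
    ultimately show ?thesis by simp
  qed
  have edges: "e \<in> skeleton_edges \<Delta>" "e' \<in> skeleton_edges \<Delta>"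
    using e e' by (auto simp: incident_edges_def)
  have sub: "v + n *\<^sub>R edge_unit_vector v e \<in> e" "v + n' *\<^sub>R edge_unit_vector v e' \<in> e'"
    using n(2) n'(2) rel_interior_subset by blast+
  show "e = e'"
  proof (cases "n \<le> n'")
    case True
    then have "v + n *\<^sub>R edge_unit_vector v e \<in> e'"
      using seg[OF n'(4,3) sub(2) n(1)] by (simp add: eq)
    then show ?thesis by (rule edges_meeting_in_interior_eq[OF edges n(2)])
  next
    case False
    then have "v + n' *\<^sub>R edge_unit_vector v e' \<in> e"
      using seg[OF n(4,3) sub(1) n'(1)] by (simp add: eq)
    then show ?thesis using edges_meeting_in_interior_eq[OF edges(2,1) n'(2)] by simp
  qed
qed

text \<open>
  The dual cells of the edges at \<open>v\<close> are the faces of the dual polytope of \<open>v\<close> in the directions of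
  these edges, so equilibrium at \<open>v\<close> is the Minkowski relation of this polytope.
\<close>
lemma self_stress_dual_volume:
  "self_stress (skeleton_vertices \<Delta>) (skeleton_edges \<Delta>) dual_volume"
  unfolding self_stress_def
proof (intro ballI conjI finite_incident_edges)
  fix v assume v: "v \<in> skeleton_vertices \<Delta>"
  let ?I = "incident_edges (skeleton_edges \<Delta>) v" and ?u = "edge_unit_vector v"
  have "dual_volume e =
      measure lebesgue (prism (dual_cell {v} \<inter> {p. ?u e \<bullet> p = edge_slope v e}) (?u e))" if e: "e \<in> ?I" for e
  proof -
    have "aff_dim e = 1" "v extreme_point_of e"
      using e by (auto simp: incident_edges_def skeleton_edges_def edge_of_def)
    then have "edge_direction e = ?u e \<or> edge_direction e = - ?u e"
      by (rule edge_direction_edge_unit_vector)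
    then show ?thesis
      unfolding dual_volume_def dual_edge_face_of_dual_vertex[OF e, symmetric]
      by (auto simp: measure_prism_uminus)
  qed
  then have "(\<Sum>e\<in>?I. dual_volume e *\<^sub>R ?u e) =
    (\<Sum>e\<in>?I. measure lebesgue (prism (dual_cell {v} \<inter> {p. ?u e \<bullet> p = edge_slope v e}) (?u e)) *\<^sub>R ?u e)"
    by simp
  also have "\<dots> = 0"
    by (rule minkowski_relation[OF finite_incident_edges inj_on_edge_unit_vector norm_edge_unit_vector
          compact_dual_cell dual_vertex_eq_edge_halfspaces[OF v]]) auto
  finally show "(\<Sum>e\<in>?I. dual_volume e *\<^sub>R ?u e) = 0" .
qed

end

section \<open>Convex surfaces as maxima of affine functions\<close>

lemma full_dimensional_interior:
  fixes C :: "'a::euclidean_space set"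
  assumes "convex C" "aff_dim C = int DIM('a)"
  shows "interior C \<noteq> {}"
proof -
  have "C \<noteq> {}" using assms(2) by auto
  then have "rel_interior C \<noteq> {}" using rel_interior_eq_empty[OF assms(1)] by simp
  moreover have "affine hull C = UNIV" using assms(2) by (simp add: aff_dim_eq_full)
  ultimately show ?thesis by (simp add: rel_interior_interior)
qed

lemma beyond_interior_point:
  fixes C :: "'a::euclidean_space set"
  assumes "x \<in> interior C"
  obtains r where "0 < r" "r < 1" "\<exists>z\<in>C. x = (1 - r) *\<^sub>R z + r *\<^sub>R y"
proof -
  obtain \<epsilon> where \<epsilon>: "\<epsilon> > 0" "ball x \<epsilon> \<subseteq> C" using assms by (meson mem_interior)
  define d where "d = \<epsilon> / (2 * (norm (y - x) + 1))"
  have "norm (y - x) + 1 > 0" using norm_ge_zero[of "y - x"] by linarith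
  then have d: "d > 0" using \<epsilon>(1) by (simp add: d_def)
  have "d * norm (y - x) \<le> d * (norm (y - x) + 1)" using d by simp
  also have "\<dots> = \<epsilon> / 2" using \<open>norm (y - x) + 1 > 0\<close> by (simp add: d_def field_simps)
  finally have "x - d *\<^sub>R (y - x) \<in> ball x \<epsilon>" using d \<epsilon>(1) by (simp add: dist_norm)
  then have z: "x - d *\<^sub>R (y - x) \<in> C" using \<epsilon>(2) by blast
  define r where "r = d / (1 + d)"
  have r: "0 < r" "r < 1" "(1 - r) * d = r" using d by (auto simp: r_def field_simps)
  have "(1 - r) *\<^sub>R (x - d *\<^sub>R (y - x)) + r *\<^sub>R y = x + (r - (1 - r) * d) *\<^sub>R (y - x)"
    by (simp add: algebra_simps)
  also have "\<dots> = x" using r(3) by simp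
  finally show ?thesis using that[OF r(1,2)] z by metis
qed

text \<open>
  The supporting hyperplane of the epigraph at a point over the interior of \<open>fst ` F\<close> cannot be vertical,
  hence is the graph of an affine minorant of \<open>f\<close>. Minorant and \<open>f\<close> agree on \<open>fst ` F\<close>, because \<open>F\<close> is
  convex and lies on the graph, so that their difference is affine on \<open>fst ` F\<close>, nonnegative, and zero at
  an interior point. They agree nowhere else because \<open>F\<close> is a face: a further point of
  contact could be joined through the point over \<open>x0\<close> to a point of \<open>F\<close> by a segment in the epigraph.
\<close>
lemma facet_is_contact_set:
  fixes f :: "'a::euclidean_space \<Rightarrow> real"
  assumes f: "convex_on UNIV f" and F: "F face_of {(x, t). f x \<le> t}" and inj: "inj_on fst F"
    and int: "interior (fst ` F) \<noteq> {}"
  shows "\<exists>a b. (\<forall>x. a \<bullet> x + b \<le> f x) \<and> (\<forall>x. x \<in> fst ` F \<longleftrightarrow> f x = a \<bullet> x + b)"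
proof -
  let ?E = "{(x, t). f x \<le> t}"
  have convE: "convex ?E"
  proof -
    have "?E = epigraph UNIV f" by (auto simp: epigraph_def)
    then show ?thesis using f by (simp add: convex_epigraph)
  qed
  have FE: "F \<subseteq> ?E" by (rule face_of_imp_subset[OF F])
  have face: "p \<in> F \<and> q \<in> F"
    if "p \<in> ?E" "q \<in> ?E" "r \<in> F" "r = (1 - s) *\<^sub>R p + s *\<^sub>R q" "0 < s" "s < 1" "p \<noteq> q" for p q r s
  proof -
    have "r \<in> open_segment p q" using that(4-7) unfolding in_segment by blast
    then show ?thesis using F that(1-3) unfolding face_of_def by blast
  qed
  \<comment> \<open>A point of \<open>F\<close> above the graph would drag a vertical segment into \<open>F\<close>, against injectivity.\<close>
  have graph: "t = f x" if xt: "(x, t) \<in> F" for x t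
  proof (rule ccontr)
    assume ne: "t \<noteq> f x"
    then have lt: "f x < t" using xt FE by auto
    have "(x, f x) \<in> F \<and> (x, 2 * t - f x) \<in> F"
      by (rule face[OF _ _ xt, of _ _ "1/2"]) (use lt in \<open>auto simp: scaleR_add_left[symmetric] field_simps\<close>)
    then have "(x, f x) = (x, t)" using inj_onD[OF inj, of "(x, f x)" "(x, t)"] xt by simp
    with ne show False by simp
  qed
  have mem: "x \<in> fst ` F \<longleftrightarrow> (x, f x) \<in> F" for x using graph by force
  obtain x0 where x0: "x0 \<in> interior (fst ` F)" using int by blast
  then have x0F: "(x0, f x0) \<in> F" using mem interior_subset by blast
  have "(x0, f x0 + 1) \<notin> F" using graph by fastforce
  then have "F \<noteq> ?E" by auto
  then have nri: "(x0, f x0) \<notin> rel_interior ?E"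
    using face_of_disjoint_rel_interior[OF F] x0F by blast
  have "(x0, f x0) \<in> ?E" by simp
  then obtain n where n: "n \<noteq> 0" "\<And>y. y \<in> ?E \<Longrightarrow> n \<bullet> (x0, f x0) \<le> n \<bullet> y"
    by (rule supporting_hyperplane_rel_boundary[OF convE _ nri]) (rule that)
  obtain p q where pq: "n = (p, q)" by (cases n)
  have supp: "p \<bullet> x0 + q * f x0 \<le> p \<bullet> y + q * t" if "f y \<le> t" for y t
    using n(2)[of "(y, t)"] that by (simp add: pq)
  have "q \<ge> 0" using supp[of x0 "f x0 + 1"] by (simp add: algebra_simps)
  moreover have "q \<noteq> 0"
  proof
    assume "q = 0"
    then have "p \<bullet> x0 \<le> p \<bullet> (x0 - p)" using supp[of "x0 - p" "f (x0 - p)"] by simp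
    then have "p \<bullet> p \<le> 0" by (simp add: inner_simps)
    then have "p = 0" by (metis inner_gt_zero_iff not_le)
    with \<open>q = 0\<close> n(1) pq show False by (simp add: zero_prod_def)
  qed
  ultimately have q: "q > 0" by simp
  define a where "a = (- 1 / q) *\<^sub>R p"
  define b where "b = f x0 - a \<bullet> x0"
  have below: "a \<bullet> y + b \<le> f y" for y
  proof -
    have qa: "q * (a \<bullet> w) = - (p \<bullet> w)" for w using q by (simp add: a_def)
    have "q * (a \<bullet> y + b) = q * (a \<bullet> y) + q * f x0 - q * (a \<bullet> x0)"
      by (simp add: b_def algebra_simps)
    also have "\<dots> \<le> q * f y" unfolding qa using supp[of y "f y"] by simp
    finally show ?thesis using q by simp
  qed
  have "y \<in> fst ` F \<longleftrightarrow> f y = a \<bullet> y + b" for y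
  proof (cases "y = x0")
    case True
    then show ?thesis using x0F mem by (simp add: b_def)
  next
    case False
    obtain r z where r: "0 < r" "r < 1" and z: "z \<in> fst ` F" and x0eq: "x0 = (1 - r) *\<^sub>R z + r *\<^sub>R y"
      using beyond_interior_point[OF x0, of y] by metis
    have lin: "a \<bullet> x0 + b = (1 - r) * (a \<bullet> z + b) + r * (a \<bullet> y + b)"
      unfolding x0eq by (simp add: inner_simps algebra_simps)
    have zy: "z \<noteq> y" using x0eq False by (auto simp: algebra_simps)
    have fx0: "f x0 = a \<bullet> x0 + b" by (simp add: b_def)
    have contact: "f w = a \<bullet> w + b" if w: "w \<in> fst ` F" for w
    proof (cases "w = x0")
      case False
      obtain s u where s: "0 < s" "s < 1" and u: "u \<in> fst ` F" and ueq: "x0 = (1 - s) *\<^sub>R u + s *\<^sub>R w"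
        using beyond_interior_point[OF x0, of w] by metis
      have "(1 - s) *\<^sub>R (u, f u) + s *\<^sub>R (w, f w) \<in> F"
        using face_of_imp_convex[OF F] u w s mem by (intro convexD_alt) auto
      then have "(1 - s) * f u + s * f w = f x0" using graph ueq by simp
      moreover have "a \<bullet> x0 + b = (1 - s) * (a \<bullet> u + b) + s * (a \<bullet> w + b)"
        unfolding ueq by (simp add: inner_simps algebra_simps)
      ultimately have "(1 - s) * (f u - (a \<bullet> u + b)) + s * (f w - (a \<bullet> w + b)) = 0"
        using fx0 by (simp add: algebra_simps)
      moreover have "(1 - s) * (f u - (a \<bullet> u + b)) \<ge> 0" "s * (f w - (a \<bullet> w + b)) \<ge> 0"
        using s below by simp_all
      ultimately have "s * (f w - (a \<bullet> w + b)) = 0" by linarith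
      with s show ?thesis by simp
    qed (simp add: fx0)
    show ?thesis
    proof
      assume fy: "f y = a \<bullet> y + b"
      have "f x0 = (1 - r) * f z + r * f y" using lin fx0 fy contact[OF z] by simp
      with x0eq have "(x0, f x0) = (1 - r) *\<^sub>R (z, f z) + r *\<^sub>R (y, f y)" by simp
      from face[OF _ _ x0F this r] have "(y, f y) \<in> F" using zy by blast
      then show "y \<in> fst ` F" using mem by simp
    qed (rule contact)
  qed
  with below show ?thesis by blast
qed

text \<open>
  Near \<open>x\<close> the function uses finitely many affine functions. The one of a cell that meets the
  neighbourhood must be among them, for otherwise an open part of the cell would be covered by
  finitely many hyperplanes. Distinct cells have distinct affine functions, so only
  finitely many come near \<open>x\<close>.
\<close>
lemma locally_finite_affine_pieces:
  fixes f :: "'a::euclidean_space \<Rightarrow> real"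
  assumes f: "piecewise_linear f"
    and C: "\<And>C. C \<in> \<Delta> \<Longrightarrow> convex C \<and> interior C \<noteq> {}"
    and g: "\<And>C x. C \<in> \<Delta> \<Longrightarrow> x \<in> C \<longleftrightarrow> f x = g C \<bullet> x + c C"
  shows "\<exists>U. open U \<and> x \<in> U \<and> finite {C\<in>\<Delta>. C \<inter> U \<noteq> {}}"
proof -
  obtain U L where U: "open U" "x \<in> U" and L: "finite L" "\<forall>y\<in>U. \<exists>(a, b)\<in>L. f y = a \<bullet> y + b"
    using f unfolding piecewise_linear_def by metis
  let ?\<Delta> = "{C\<in>\<Delta>. C \<inter> U \<noteq> {}}"
  have "(g C, c C) \<in> L" if C': "C \<in> ?\<Delta>" for C
  proof (rule ccontr)
    assume notL: "(g C, c C) \<notin> L"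
    have CD: "C \<in> \<Delta>" "C \<inter> U \<noteq> {}" using C' by auto
    let ?V = "interior C \<inter> U"
    have "C \<subseteq> closure (interior C)"
      using convex_closure_interior[of C] C[OF CD(1)] closure_subset[of C] by auto
    then have "?V \<noteq> {}" using CD(2) U(1) open_Int_closure_eq_empty[of U "interior C"] by blast
    moreover have "open ?V" using U(1) by auto
    ultimately have "\<not> negligible ?V" using open_not_negligible by blast
    moreover have "?V \<subseteq> (\<Union>(a, b)\<in>L. {y. (g C - a) \<bullet> y = b - c C})"
    proof
      fix y assume y: "y \<in> ?V"
      then obtain a b where ab: "(a, b) \<in> L" "f y = a \<bullet> y + b" using L(2) by blast
      have "f y = g C \<bullet> y + c C" using g[OF CD(1)] y interior_subset by blast
      with ab have "(g C - a) \<bullet> y = b - c C" by (simp add: inner_diff_left)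
      with ab(1) show "y \<in> (\<Union>(a, b)\<in>L. {y. (g C - a) \<bullet> y = b - c C})" by blast
    qed
    moreover have "negligible (\<Union>(a, b)\<in>L. {y. (g C - a) \<bullet> y = b - c C})"
    proof (intro negligible_Union finite_imageI L(1), safe)
      fix a b assume "(a, b) \<in> L"
      with notL have "g C - a \<noteq> 0 \<or> b - c C \<noteq> 0" by auto
      then show "negligible {y. (g C - a) \<bullet> y = b - c C}" by (rule negligible_hyperplane)
    qed
    ultimately show False using negligible_subset by blast
  qed
  then have "(\<lambda>C. (g C, c C)) ` ?\<Delta> \<subseteq> L" by blast
  moreover have "inj_on (\<lambda>C. (g C, c C)) ?\<Delta>"
  proof (rule inj_onI)
    fix C D assume "C \<in> ?\<Delta>" "D \<in> ?\<Delta>" "(g C, c C) = (g D, c D)"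
    then have "y \<in> C \<longleftrightarrow> y \<in> D" for y using g[of C y] g[of D y] by simp
    then show "C = D" by blast
  qed
  ultimately have "finite ?\<Delta>" using L(1) by (meson finite_subset inj_on_finite)
  with U show ?thesis by blast
qed

lemma max_affine_cells_of_surface:
  fixes \<Delta> :: "'a::euclidean_space set set"
  assumes \<Delta>: "cell_decomposition \<Delta>" and S: "convex_surface S" "projects_onto S \<Delta>"
  obtains f g c where "max_affine_cells \<Delta> f g c"
proof -
  obtain f where f: "convex_on UNIV f" "piecewise_linear f" and Seq: "S = range (\<lambda>x. (x, f x))"
    using S(1) unfolding convex_surface_def by blast
  have epi: "{(x, t). \<exists>y\<le>t. (x, y) \<in> S} = {(x, t). f x \<le> t}" by (auto simp: Seq)
  have conv: "convex C \<and> interior C \<noteq> {}" if "C \<in> \<Delta>" for C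
    using \<Delta> that full_dimensional_interior polyhedron_imp_convex unfolding cell_decomposition_def by blast
  have "\<exists>a b. (\<forall>x. a \<bullet> x + b \<le> f x) \<and> (\<forall>x. x \<in> C \<longleftrightarrow> f x = a \<bullet> x + b)" if C: "C \<in> \<Delta>" for C
  proof -
    have "C \<in> (\<lambda>F. fst ` F) ` surface_facets S"
      using S(2) C unfolding projects_onto_def bij_betw_def by blast
    then obtain F where F: "F \<in> surface_facets S" "C = fst ` F" by blast
    then have "F face_of {(x, t). f x \<le> t}" "inj_on fst F"
      using S(2) epi by (auto simp: surface_facets_def projects_onto_def facet_of_imp_face_of)
    with f(1) conv[OF C] show ?thesis unfolding F(2) by (intro facet_is_contact_set) auto
  qed
  then obtain g c where gc: "\<And>C x. C \<in> \<Delta> \<Longrightarrow> g C \<bullet> x + c C \<le> f x"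
    "\<And>C x. C \<in> \<Delta> \<Longrightarrow> x \<in> C \<longleftrightarrow> f x = g C \<bullet> x + c C"
    by metis
  have "max_affine_cells \<Delta> f g c"
    using \<Delta> gc locally_finite_affine_pieces[OF f(2) conv gc(2)] by unfold_locales auto
  then show ?thesis by (rule that)
qed

section \<open>The positive self-stress\<close>

lemma framework_skeleton:
  assumes "cell_decomposition \<Delta>"
  shows "framework (skeleton_vertices \<Delta>) (skeleton_edges \<Delta>)"
  unfolding framework_def
proof
  fix e assume "e \<in> skeleton_edges \<Delta>"
  then obtain C where C: "C \<in> \<Delta>" "e face_of C" "aff_dim e = 1"
    by (auto simp: skeleton_edges_def edge_of_def)
  then have "polyhedron C" using assms by (auto simp: cell_decomposition_def)
  then have "closed e"
    using face_of_imp_closed[OF polyhedron_imp_convex polyhedron_imp_closed C(2)] by blast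
  moreover have "v extreme_point_of e \<Longrightarrow> v \<in> skeleton_vertices \<Delta>" for v
    using extreme_point_of_face[OF C(2)] C(1) by (auto simp: skeleton_vertices_def)
  ultimately show "closed e \<and> convex e \<and> aff_dim e = 1 \<and>
      (\<forall>v. v extreme_point_of e \<longrightarrow> v \<in> skeleton_vertices \<Delta>)"
    using face_of_imp_convex[OF C(2)] C(3) by blast
qed

theorem corollary5p3:
  fixes \<Delta> :: "'a::euclidean_space set set"
  assumes "cell_decomposition \<Delta>"
    and "\<exists>S :: ('a \<times> real) set. convex_surface S \<and> projects_onto S \<Delta>"
  shows "(\<exists>s. self_stress (skeleton_vertices \<Delta>) (skeleton_edges \<Delta>) s \<and>
              (\<forall>e\<in>skeleton_edges \<Delta>. s e > 0)) \<and>
         spider_web (skeleton_vertices \<Delta>) (skeleton_edges \<Delta>)"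
proof -
  obtain S :: "('a \<times> real) set" where "convex_surface S" "projects_onto S \<Delta>"
    using assms(2) by blast
  then obtain f g c where "max_affine_cells \<Delta> f g c"
    by (rule max_affine_cells_of_surface[OF assms(1)])
  then interpret max_affine_cells \<Delta> f g c .
  have "\<exists>s. self_stress (skeleton_vertices \<Delta>) (skeleton_edges \<Delta>) s \<and>
      (\<forall>e\<in>skeleton_edges \<Delta>. s e > 0)"
    using self_stress_dual_volume dual_edge_volume_pos by blast
  with framework_skeleton[OF assms(1)] show ?thesis
    unfolding spider_web_def by blast
qed

end
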